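(* Assume the continuum hypothesis (CH), and let $n\ge 1$. Let $$K_n=\{(\mathbb{R},<,Q_1,\ldots,Q_n): Q_1,\dots,Q_n\subseteq \mathbb{R}\}.$$ The monadic theory of $K_n$, where the set quantifiers range over countable subsets of $\mathbb{R}$, is undecidable. Moreover, the same is true when the set quantifiers range only over sets of rationals.
   Context: Monadic logic is first-order logic augmented by set variables and quantification over them; ordinarily these range over all subsets of the universe, but here they are restricted to the indicated family of subsets. The language of $K_n$ consists of $<$ and $n$ one-place predicates. The monadic theory of a class $K$ of structures is the set of all monadic sentences true (under the indicated interpretation of the set quantifiers) in every member of $K$. *)

theory Defs
  imports
    Complex_Main
    "HOL-Library.Countable_Set"
    "HOL-Library.Equipollence"
    "HOL-Library.Nat_Bijection"
begin

section \<open>Monadic logic of order with unary predicates\<close>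

text \<open>Individual variables and set variables are two separate sorts, each indexed by natural
  numbers. \<open>Pred i x\<close> says that \<open>x\<close> lies in the \<open>i\<close>-th predicate of the structure, counting from 0.\<close>

datatype mform =
    Less nat nat
  | Equal nat nat
  | Pred nat nat
  | Mem nat nat  \<comment> \<open>individual variable, then set variable\<close>
  | Neg mform
  | Conj mform mform
  | ExI nat mform
  | ExS nat mform

primrec preds_of :: "mform \<Rightarrow> nat set" where
  "preds_of (Less x y) = {}"
| "preds_of (Equal x y) = {}"
| "preds_of (Pred i x) = {i}"
| "preds_of (Mem x X) = {}"
| "preds_of (Neg p) = preds_of p"
| "preds_of (Conj p q) = preds_of p \<union> preds_of q"
| "preds_of (ExI x p) = preds_of p"
| "preds_of (ExS X p) = preds_of p"

primrec free_ind :: "mform \<Rightarrow> nat set" where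
  "free_ind (Less x y) = {x, y}"
| "free_ind (Equal x y) = {x, y}"
| "free_ind (Pred i x) = {x}"
| "free_ind (Mem x X) = {x}"
| "free_ind (Neg p) = free_ind p"
| "free_ind (Conj p q) = free_ind p \<union> free_ind q"
| "free_ind (ExI x p) = free_ind p - {x}"
| "free_ind (ExS X p) = free_ind p"

primrec free_set :: "mform \<Rightarrow> nat set" where
  "free_set (Less x y) = {}"
| "free_set (Equal x y) = {}"
| "free_set (Pred i x) = {}"
| "free_set (Mem x X) = {X}"
| "free_set (Neg p) = free_set p"
| "free_set (Conj p q) = free_set p \<union> free_set q"
| "free_set (ExI x p) = free_set p"
| "free_set (ExS X p) = free_set p - {X}"

definition monadic_sentence :: "nat \<Rightarrow> mform \<Rightarrow> bool" where
  "monadic_sentence n p \<longleftrightarrow> preds_of p \<subseteq> {..<n} \<and> free_ind p = {} \<and> free_set p = {}"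

text \<open>The universe of a structure is the whole type \<open>'a\<close>.\<close>

record 'a model =
  lt :: "'a \<Rightarrow> 'a \<Rightarrow> bool"
  preds :: "'a set list"

text \<open>Set quantifiers range over the family \<open>F\<close>; individual quantifiers range over the whole universe.\<close>

primrec sat ::
    "'a set set \<Rightarrow> 'a model \<Rightarrow> (nat \<Rightarrow> 'a) \<Rightarrow> (nat \<Rightarrow> 'a set) \<Rightarrow> mform \<Rightarrow> bool" where
  "sat F M e E (Less x y) \<longleftrightarrow> lt M (e x) (e y)"
| "sat F M e E (Equal x y) \<longleftrightarrow> e x = e y"
| "sat F M e E (Pred i x) \<longleftrightarrow> e x \<in> preds M ! i"
| "sat F M e E (Mem x X) \<longleftrightarrow> e x \<in> E X"
| "sat F M e E (Neg p) \<longleftrightarrow> \<not> sat F M e E p"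
| "sat F M e E (Conj p q) \<longleftrightarrow> sat F M e E p \<and> sat F M e E q"
| "sat F M e E (ExI x p) \<longleftrightarrow> (\<exists>a. sat F M (e(x := a)) E p)"
| "sat F M e E (ExS X p) \<longleftrightarrow> (\<exists>A\<in>F. sat F M e (E(X := A)) p)"

definition monadic_theory :: "nat \<Rightarrow> 'a set set \<Rightarrow> 'a model set \<Rightarrow> mform set" where
  "monadic_theory n F K =
     {p. monadic_sentence n p \<and> (\<forall>M\<in>K. \<forall>e E. sat F M e E p)}"

definition real_models :: "nat \<Rightarrow> real model set" where
  "real_models n = {\<lparr>lt = (<), preds = Qs\<rparr> | Qs. length Qs = n}"

lemma sat_cong:
  assumes "\<And>x. x \<in> free_ind p \<Longrightarrow> e x = e' x" "\<And>X. X \<in> free_set p \<Longrightarrow> E X = E' X"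
  shows "sat F M e E p \<longleftrightarrow> sat F M e' E' p"
  using assms
proof (induction p arbitrary: e e' E E')
  case (Neg p)
  have "sat F M e E p \<longleftrightarrow> sat F M e' E' p"
    by (rule Neg.IH) (use Neg.prems in simp_all)
  then show ?case by simp
next
  case (Conj p q)
  have "sat F M e E p \<longleftrightarrow> sat F M e' E' p"
    by (rule Conj.IH(1)) (use Conj.prems in simp_all)
  moreover have "sat F M e E q \<longleftrightarrow> sat F M e' E' q"
    by (rule Conj.IH(2)) (use Conj.prems in simp_all)
  ultimately show ?case by simp
next
  case (ExI x p)
  have "sat F M (e(x := a)) E p \<longleftrightarrow> sat F M (e'(x := a)) E' p" for a
    by (rule ExI.IH) (use ExI.prems in auto)
  then show ?case by simp
next
  case (ExS X p)
  have "sat F M e (E(X := A)) p \<longleftrightarrow> sat F M e' (E'(X := A)) p" for A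
    by (rule ExS.IH) (use ExS.prems in auto)
  then show ?case by simp
qed simp_all


section \<open>Decidability\<close>

text \<open>Programs for partial recursive functions: zero, successor, projections, composition,
  primitive recursion (on the first argument) and unbounded minimisation (over the first argument).
  Arities are implicit: a program applied to a list of unsuitable length just has no value,
  or ignores the superfluous arguments.\<close>

datatype recf =
    Zero
  | Succ
  | Proj nat
  | Comp recf "recf list"
  | PrimRec recf recf
  | Minim recf

inductive computes :: "recf \<Rightarrow> nat list \<Rightarrow> nat \<Rightarrow> bool" where
  "computes Zero xs 0"
| "computes Succ [x] (Suc x)"
| "i < length xs \<Longrightarrow> computes (Proj i) xs (xs ! i)"
| "list_all2 (\<lambda>g y. computes g xs y) gs ys \<Longrightarrow> computes f ys z \<Longrightarrow> computes (Comp f gs) xs z"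
| "computes f xs y \<Longrightarrow> computes (PrimRec f g) (0 # xs) y"
| "computes (PrimRec f g) (k # xs) y \<Longrightarrow> computes g (k # y # xs) z \<Longrightarrow>
     computes (PrimRec f g) (Suc k # xs) z"
| "computes f (k # xs) 0 \<Longrightarrow> \<forall>j<k. \<exists>y. computes f (j # xs) (Suc y) \<Longrightarrow>
     computes (Minim f) xs k"

inductive_cases computes_elims:
  "computes Zero xs y" "computes Succ xs y" "computes (Proj i) xs y" "computes (Comp f gs) xs y"
  "computes (PrimRec f g) (0 # xs) y" "computes (PrimRec f g) (Suc k # xs) y"
  "computes (Minim f) xs y"

lemma computes_deterministic: "computes f xs y \<Longrightarrow> computes f xs z \<Longrightarrow> y = z"
proof (induction arbitrary: z rule: computes.induct)
  case (1 xs)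
  then show ?case by (rule computes_elims(1)) simp
next
  case (2 x)
  then show ?case by (rule computes_elims(2)) simp
next
  case (3 i xs)
  from 3(2) show ?case by (rule computes_elims(3)) simp
next
  case (4 xs gs ys f y)
  from "4.prems" obtain ys' where ys': "list_all2 (\<lambda>g y. computes g xs y) gs ys'" "computes f ys' z"
    by (rule computes_elims(4))
  have "ys = ys'"
    using "4.IH"(1) ys'(1) by (auto simp: list_all2_conv_all_nth intro!: nth_equalityI)
  then show ?case using "4.IH"(2) ys'(2) by blast
next
  case (5 f xs y g)
  from "5.prems" show ?case by (rule computes_elims(5)) (rule "5.IH")
next
  case (6 f g k xs y w)
  from "6.prems" obtain y' where "computes (PrimRec f g) (k # xs) y'" "computes g (k # y' # xs) z"
    by (rule computes_elims(6))
  then show ?case using "6.IH" by blast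
next
  case (7 f k xs)
  from "7.prems" have z: "computes f (z # xs) 0 \<and> (\<forall>j<z. \<exists>y. computes f (j # xs) (Suc y))"
    by (rule computes_elims(7)) simp
  show ?case
  proof (rule linorder_cases[of k z])
    assume "k < z"
    then obtain y where "computes f (k # xs) (Suc y)" using z by blast
    then show ?thesis using "7.IH"(1) by (metis nat.distinct(1))
  next
    assume "z < k"
    then obtain y where "\<And>w. computes f (z # xs) w \<Longrightarrow> Suc y = w" using "7.IH"(2) by blast
    then show ?thesis using z by (metis nat.distinct(1))
  qed
qed

definition decidable_set :: "nat set \<Rightarrow> bool" where
  "decidable_set A \<longleftrightarrow> (\<exists>f. \<forall>x. computes f [x] (if x \<in> A then 1 else 0))"

text \<open>An effective Goedel numbering, based on the (primitive recursive) Cantor pairing function.\<close>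

primrec goedel :: "mform \<Rightarrow> nat" where
  "goedel (Less x y) = prod_encode (0, prod_encode (x, y))"
| "goedel (Equal x y) = prod_encode (1, prod_encode (x, y))"
| "goedel (Pred i x) = prod_encode (2, prod_encode (i, x))"
| "goedel (Mem x X) = prod_encode (3, prod_encode (x, X))"
| "goedel (Neg p) = prod_encode (4, goedel p)"
| "goedel (Conj p q) = prod_encode (5, prod_encode (goedel p, goedel q))"
| "goedel (ExI x p) = prod_encode (6, prod_encode (x, goedel p))"
| "goedel (ExS X p) = prod_encode (7, prod_encode (X, goedel p))"

lemma inj_goedel: "inj goedel"
proof (rule injI)
  show "goedel p = goedel q \<Longrightarrow> p = q" for p q
    by (induction p arbitrary: q; case_tac q) auto
qed

definition decidable_theory :: "mform set \<Rightarrow> bool" where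
  "decidable_theory T \<longleftrightarrow> decidable_set (goedel ` T)"


section \<open>The continuum hypothesis\<close>

definition continuum_hypothesis :: bool where
  "continuum_hypothesis \<longleftrightarrow> (\<forall>A :: real set. countable A \<or> A \<approx> (UNIV :: real set))"

end

theory Submission
  imports Defs "HOL-Analysis.Analysis"
begin

text \<open>
  Colour the rationals such that each of countably many colours is dense, and let a reflexive and
  symmetric relation on the colours be given. By CH the sets of rationals can be ordered with countable
  initial segments. Call a set of rationals good if the rationals in its closure have only two, related,
  colours, and bad if it is dense in itself and remains so relatively to the points outside any two
  related colours. For every bad set choose a point in its closure that is irrational and outside
  the closures of all earlier good sets, by Baire's theorem. The set \<open>Q\<close> of these points meets the closure
  of every bad set, and the closure of a good set in countably many points only, which can be avoided by
  thinning out the good set.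

  Thus \<open>Q\<close> encodes the relation: a dense set of rationals that is locally of one colour (a token)
  represents this colour, and two tokens represent related colours if and only if every interval contains
  a set whose closure misses \<open>Q\<close> and in which both tokens are dense. With four copies of the set of binary
  trees as colours, the pairing of trees becomes definable. The graphs of recursive functions are generated
  by Horn clauses over binary trees, and Horn clauses survive the passage from trees to tokens, that is, to
  locally constant functions into trees. Hence the sentence ``if the pairing axioms and the clauses hold,
  then program \<open>q\<close> maps \<open>x\<close> to 0'' is true for all \<open>Q\<close> if and only if \<open>q\<close> maps \<open>x\<close> to 0, and a diagonal
  argument applies.
\<close>

section \<open>Using the continuum hypothesis\<close>

text \<open>The relation \<open>card_of\<close> is a well-order of least possible type, so its
  proper initial segments have smaller cardinality than the reals; CH leaves only
  countability.\<close>

lemma underS_countable_under_CH: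
  assumes "continuum_hypothesis"
  shows "countable (underS (card_of (UNIV :: real set)) x)"
proof (rule ccontr)
  assume "uncountable (underS (card_of (UNIV :: real set)) x)"
  then have "underS (card_of (UNIV :: real set)) x \<approx> (UNIV :: real set)"
    using assms by (auto simp: continuum_hypothesis_def)
  then have "(card_of (underS (card_of (UNIV :: real set)) x), card_of (UNIV :: real set)) \<in> ordIso"
    by (simp add: eqpoll_def card_of_ordIso)
  moreover have "(card_of (underS (card_of (UNIV :: real set)) x), card_of (UNIV :: real set)) \<in> ordLess"
    by (rule card_of_underS[OF card_of_Card_order]) (simp add: Field_card_of)
  ultimately show False
    using not_ordLess_ordIso by blast
qed

text \<open>The minimal well-order of the reals is pulled back along an injection, and
  \<open>r Y X\<close> means that \<open>Y\<close> comes strictly before \<open>X\<close>. By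
  totality, an \<open>X\<close> with \<open>\<not> r Y X\<close> is \<open>Y\<close> itself or comes
  before it.\<close>

lemma CH_ordering:
  fixes \<A> :: "'a set"
  assumes "continuum_hypothesis" "\<A> \<lesssim> (UNIV :: real set)"
  obtains r :: "'a \<Rightarrow> 'a \<Rightarrow> bool"
  where "\<And>Y. countable {X\<in>\<A>. \<not> r Y X}" "\<And>X. countable {Y\<in>\<A>. r Y X}"
proof -
  obtain g :: "'a \<Rightarrow> real" where g: "inj_on g \<A>"
    using assms(2) by (auto simp: lepoll_def)
  let ?W = "(card_of (UNIV :: real set))"
  define r where "r Y X \<longleftrightarrow> g Y \<in> underS ?W (g X)" for X Y
  have 1: "countable {Y\<in>\<A>. r Y X}" for X
  proof (rule countable_image_inj_on)
    show "inj_on g {Y\<in>\<A>. r Y X}"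
      using g by (rule inj_on_subset) auto
    show "countable (g ` {Y\<in>\<A>. r Y X})"
      by (rule countable_subset[OF _ underS_countable_under_CH[OF assms(1), of "g X"]])
        (auto simp: r_def)
  qed
  have tot: "total_on UNIV ?W"
    using card_of_well_order_on[of "UNIV :: real set"] by (simp add: well_order_on_def linear_order_on_def)
  have 2: "countable {X\<in>\<A>. \<not> r Y X}" for Y
  proof (rule countable_image_inj_on)
    show "inj_on g {X\<in>\<A>. \<not> r Y X}"
      using g by (rule inj_on_subset) auto
    have "g ` {X\<in>\<A>. \<not> r Y X} \<subseteq> insert (g Y) (underS ?W (g Y))"
      using tot by (auto simp: r_def underS_def total_on_def)
    then show "countable (g ` {X\<in>\<A>. \<not> r Y X})"
      by (rule countable_subset) (simp add: underS_countable_under_CH[OF assms(1)])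
  qed
  show ?thesis using that 1 2 by blast
qed

lemma Pow_Rats_lepoll: "Pow (\<rat> :: real set) \<lesssim> (UNIV :: real set)"
proof -
  have "inj_on (\<lambda>A. to_nat_on \<rat> ` A) (Pow (\<rat> :: real set))"
    using inj_on_image_Pow[OF inj_on_to_nat_on[OF countable_rat]] by blast
  then have "Pow (\<rat> :: real set) \<lesssim> (UNIV :: nat set set)"
    by (auto simp: lepoll_def)
  then show ?thesis
    using nat_sets_eqpoll_reals by (rule lepoll_trans2)
qed

section \<open>Closures, limit points and Baire's theorem\<close>

lemma closure_real_iff:
  "x \<in> closure A \<longleftrightarrow> (\<forall>a b. a < x \<and> x < b \<longrightarrow> (\<exists>y\<in>A. a < y \<and> y < (b::real)))"
proof
  assume x: "x \<in> closure A"
  show "\<forall>a b. a < x \<and> x < b \<longrightarrow> (\<exists>y\<in>A. a < y \<and> y < b)"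
  proof (intro allI impI)
    fix a b assume "a < x \<and> x < b"
    then have "0 < min (x - a) (b - x)" by simp
    then obtain y where "y \<in> A" "dist y x < min (x - a) (b - x)"
      using x unfolding closure_approachable by blast
    then show "\<exists>y\<in>A. a < y \<and> y < b"
      by (force simp: dist_real_def)
  qed
next
  assume R: "\<forall>a b. a < x \<and> x < b \<longrightarrow> (\<exists>y\<in>A. a < y \<and> y < b)"
  show "x \<in> closure A"
    unfolding closure_approachable
  proof (intro allI impI)
    fix e :: real assume "0 < e"
    then obtain y where "y \<in> A" "x - e < y" "y < x + e"
      using R[rule_format, of "x - e" "x + e"] by auto
    then show "\<exists>y\<in>A. dist y x < e"
      by (force simp: dist_real_def)
  qed
qed

text \<open>\<open>limdense X X\<close> says that \<open>X\<close> is dense in itself. The second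
  set \<open>U\<close> allows for density relative to the points of given colours or to the
  complement of a closure.\<close>

definition limdense :: "real set \<Rightarrow> real set \<Rightarrow> bool" where
  "limdense U S \<longleftrightarrow> (\<forall>s\<in>S. \<forall>a b. a < s \<and> s < b \<longrightarrow> (\<exists>x. x \<in> U \<and> x \<in> S \<and> a < x \<and> x < b \<and> x \<noteq> s))"

lemma limdenseD:
  assumes "limdense U S" "s \<in> S" "a < s" "s < b"
  obtains x where "x \<in> U" "x \<in> S" "a < x" "x < b" "x \<noteq> s"
  using assms unfolding limdense_def by blast

lemma limdense_mono: "limdense U S \<Longrightarrow> U \<inter> S \<subseteq> V \<Longrightarrow> limdense V S"
  unfolding limdense_def by blast

text \<open>Baire's theorem in the closed set \<open>closure X\<close>: removing the closure of some
  \<open>Y\<close> or a single point leaves a relatively open set, which is dense because every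
  point of \<open>X\<close> is a limit of remaining points of \<open>X\<close>.\<close>

lemma closure_not_covered:
  fixes X K :: "real set"
  assumes "countable K" "countable \<F>" "X \<noteq> {}" "limdense X X"
    and ac: "\<And>Y. Y \<in> \<F> \<Longrightarrow> limdense (- closure Y) X"
  shows "\<exists>q \<in> closure X. q \<notin> K \<and> (\<forall>Y\<in>\<F>. q \<notin> closure Y)"
proof -
  define S where "S = closure X"
  \<comment> \<open>Including \<open>S\<close> itself keeps the intersection inside \<open>S\<close>
    even when \<open>K\<close> and \<open>\<F>\<close> are both empty.\<close>
  define \<G> where "\<G> = insert S ((\<lambda>Y. S - closure Y) ` \<F> \<union> (\<lambda>k. S - {k}) ` K)"
  have "S \<subseteq> closure (\<Inter>\<G>)"
  proof (rule Baire)
    show "closed S" by (simp add: S_def)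
    show "countable \<G>" using assms(1,2) by (simp add: \<G>_def)
    fix T assume "T \<in> \<G>"
    then have "T = S \<or> (\<exists>Y\<in>\<F>. T = S - closure Y) \<or> (\<exists>k\<in>K. T = S - {k})"
      unfolding \<G>_def by blast
    then consider "T = S" | Y where "Y \<in> \<F>" "T = S - closure Y" | k where "k \<in> K" "T = S - {k}"
      by blast
    then show "openin (top_of_set S) T \<and> S \<subseteq> closure T"
    proof cases
      case 1
      then show ?thesis by (auto simp: closure_subset)
    next
      case 2
      have "openin (top_of_set S) (S \<inter> - closure Y)"
        by (rule openin_open_Int) (rule open_Compl, simp)
      moreover have "X \<subseteq> closure T"
      proof
        fix x assume x: "x \<in> X"
        show "x \<in> closure T"
          unfolding closure_real_iff
        proof (intro allI impI)
          fix a b assume "a < x \<and> x < b"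
          then obtain y where "y \<in> - closure Y" "y \<in> X" "a < y" "y < b"
            using ac[OF 2(1)] x unfolding limdense_def by meson
          then show "\<exists>y\<in>T. a < y \<and> y < b"
            using 2(2) by (metis ComplD DiffI S_def closure_subset subsetD)
        qed
      qed
      then have "S \<subseteq> closure T"
        by (simp add: S_def closure_minimal)
      moreover have "T = S \<inter> - closure Y" using 2(2) by blast
      ultimately show ?thesis by simp
    next
      case 3
      have "openin (top_of_set S) (S \<inter> - {k})"
        by (rule openin_open_Int) (rule open_Compl, simp)
      moreover have "X \<subseteq> closure T"
      proof
        fix x assume x: "x \<in> X"
        show "x \<in> closure T"
          unfolding closure_real_iff
        proof (intro allI impI)
          fix a b assume ab: "a < x \<and> x < b"
          then obtain y where "y \<in> X" "a < y" "y < b" "y \<noteq> x"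
            using assms(4) x unfolding limdense_def by meson
          \<comment> \<open>If \<open>k\<close> differs from \<open>x\<close>, then \<open>x\<close>
            is the witness; otherwise \<open>y\<close> is.\<close>
          then show "\<exists>y\<in>T. a < y \<and> y < b"
            using 3(2) x ab by (metis DiffI S_def closure_subset singletonD subsetD)
        qed
      qed
      then have "S \<subseteq> closure T"
        by (simp add: S_def closure_minimal)
      moreover have "T = S \<inter> - {k}" using 3(2) by blast
      ultimately show ?thesis by simp
    qed
  qed
  moreover have "S \<noteq> {}" using assms(3) by (simp add: S_def)
  ultimately have "closure (\<Inter>\<G>) \<noteq> {}" by (metis subset_empty)
  then have "\<Inter>\<G> \<noteq> {}" by (metis closure_empty)
  then obtain q where "q \<in> \<Inter>\<G>" by blast
  then have q: "q \<in> T" if "T \<in> \<G>" for T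
    using that by blast
  have "q \<in> S" using q[of S] by (simp add: \<G>_def)
  moreover have "q \<notin> closure Y" if "Y \<in> \<F>" for Y
    using q[of "S - closure Y"] that by (simp add: \<G>_def)
  moreover have "q \<notin> K"
    using q[of "S - {q}"] by (auto simp: \<G>_def)
  ultimately show ?thesis by (auto simp: S_def)
qed

text \<open>Each bad \<open>X\<close> gets a point \<open>q X\<close> of its closure outside the
  closures of the good sets before \<open>X\<close>, of which there are only countably many.
  Conversely the closure of a good \<open>Y\<close> can contain \<open>q X\<close> only if
  \<open>X\<close> does not come after \<open>Y\<close>, which again leaves countably many
  points.\<close>

theorem exists_separating_set:
  fixes K :: "real set" and c :: "real \<Rightarrow> 'l" and E :: "'l \<Rightarrow> 'l \<Rightarrow> bool"
  assumes CH: "continuum_hypothesis" and K: "K \<subseteq> \<rat>"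
  obtains Q where "Q \<inter> K = {}"
    "\<And>Y l l'. Y \<subseteq> K \<Longrightarrow> E l l' \<Longrightarrow> c ` (closure Y \<inter> K) \<subseteq> {l, l'} \<Longrightarrow> countable (closure Y \<inter> Q)"
    "\<And>X. X \<subseteq> K \<Longrightarrow> X \<noteq> {} \<Longrightarrow> limdense X X \<Longrightarrow>
        (\<And>l l'. E l l' \<Longrightarrow> limdense {x. c x \<noteq> l \<and> c x \<noteq> l'} X) \<Longrightarrow> closure X \<inter> Q \<noteq> {}"
proof -
  have "Pow K \<lesssim> (UNIV :: real set)"
    using K Pow_Rats_lepoll subset_imp_lepoll[of "Pow K" "Pow \<rat>"] lepoll_trans by blast
  then obtain r where r: "\<And>Y. countable {X\<in>Pow K. \<not> r Y X}" "\<And>X. countable {Y\<in>Pow K. r Y X}"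
    using CH_ordering[OF CH] by blast
  define good where "good Y \<longleftrightarrow> (\<exists>l l'. E l l' \<and> c ` (closure Y \<inter> K) \<subseteq> {l, l'})" for Y
  define bad where "bad X \<longleftrightarrow> X \<noteq> {} \<and> limdense X X \<and>
     (\<forall>l l'. E l l' \<longrightarrow> limdense {x. c x \<noteq> l \<and> c x \<noteq> l'} X)" for X
  have "\<exists>q. bad X \<longrightarrow> q \<in> closure X \<and> q \<notin> K \<and> (\<forall>Y\<in>{Y\<in>Pow K. r Y X \<and> good Y}. q \<notin> closure Y)"
    if "X \<in> Pow K" for X
  proof (cases "bad X")
    case True
    have "\<exists>q \<in> closure X. q \<notin> K \<and> (\<forall>Y\<in>{Y\<in>Pow K. r Y X \<and> good Y}. q \<notin> closure Y)"
    proof (rule closure_not_covered)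
      show "countable K" using K countable_rat countable_subset by blast
      show "countable {Y\<in>Pow K. r Y X \<and> good Y}"
        by (rule countable_subset[OF _ r(2)[of X]]) auto
      show "X \<noteq> {}" "limdense X X" using True by (auto simp: bad_def)
      fix Y assume "Y \<in> {Y\<in>Pow K. r Y X \<and> good Y}"
      then obtain l l' where l: "E l l'" "c ` (closure Y \<inter> K) \<subseteq> {l, l'}"
        by (auto simp: good_def)
      then have "limdense {x. c x \<noteq> l \<and> c x \<noteq> l'} X"
        using True by (auto simp: bad_def)
      \<comment> \<open>A point of \<open>X\<close> in \<open>closure Y\<close> belongs to
        \<open>K\<close>, hence has colour \<open>l\<close> or \<open>l'\<close> by goodness of
        \<open>Y\<close>.\<close>
      then show "limdense (- closure Y) X"
        by (rule limdense_mono) (use l that in auto)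
    qed
    then show ?thesis by blast
  qed blast
  then have "\<forall>X\<in>Pow K. \<exists>q. bad X \<longrightarrow>
      q \<in> closure X \<and> q \<notin> K \<and> (\<forall>Y\<in>{Y\<in>Pow K. r Y X \<and> good Y}. q \<notin> closure Y)"
    by blast
  from bchoice[OF this] obtain q where q: "\<And>X. X \<in> Pow K \<Longrightarrow> bad X \<Longrightarrow>
      q X \<in> closure X \<and> q X \<notin> K \<and> (\<forall>Y\<in>{Y\<in>Pow K. r Y X \<and> good Y}. q X \<notin> closure Y)"
    by blast
  define Q where "Q = q ` {X\<in>Pow K. bad X}"
  show ?thesis
  proof (rule that[of Q])
    show "Q \<inter> K = {}" using q by (auto simp: Q_def)
  next
    fix Y l l' assume Y: "Y \<subseteq> K" "E l l'" "c ` (closure Y \<inter> K) \<subseteq> {l, l'}"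
    then have "good Y" by (auto simp: good_def)
    then have "closure Y \<inter> Q \<subseteq> q ` {X\<in>Pow K. \<not> r Y X}"
      using q Y(1) by (auto simp: Q_def)
    then show "countable (closure Y \<inter> Q)"
      by (rule countable_subset) (use r(1)[of Y] in simp)
  next
    fix X assume "X \<subseteq> K" "X \<noteq> {}" "limdense X X"
      "\<And>l l'. E l l' \<Longrightarrow> limdense {x. c x \<noteq> l \<and> c x \<noteq> l'} X"
    then have "X \<in> Pow K" "bad X" by (auto simp: bad_def)
    then have "q X \<in> closure X" "q X \<in> Q"
      using q by (auto simp: Q_def)
    then show "closure X \<inter> Q \<noteq> {}" by blast
  qed
qed

section \<open>Thin subsets and dense colourings\<close>

text \<open>One stage of the thinning: \<open>F\<close> is the finite set of points already
  promised, \<open>V\<close> the closed region already forbidden. Every promised point receives a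
  nearby companion in \<open>X\<close> and one in \<open>Y\<close>, and then a neighbourhood of
  \<open>b\<close> that misses all promised points is forbidden.\<close>

lemma thin_step:
  fixes S V :: "real set"
  assumes F: "finite F" "F \<subseteq> S" "F \<inter> V = {}" and V: "closed V" and "b \<notin> S" "0 < e"
    and lim: "limdense X S" "limdense Y S"
  obtains F' V' where "finite F'" "F' \<subseteq> S" "F' \<inter> V' = {}" "closed V'" "F \<subseteq> F'" "V \<subseteq> V'"
    "b \<in> interior V'" "\<forall>p\<in>F. \<exists>x\<in>X \<inter> F'. x \<noteq> p \<and> \<bar>x - p\<bar> < e"
    "\<forall>p\<in>F. \<exists>x\<in>Y \<inter> F'. x \<noteq> p \<and> \<bar>x - p\<bar> < e"
proof -
  have near: "\<exists>x. x \<in> U \<and> x \<in> S \<and> x \<notin> V \<and> x \<noteq> p \<and> \<bar>x - p\<bar> < e"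
    if U: "limdense U S" and "p \<in> F" for U p
  proof -
    have "open (- V)" "p \<in> - V" using V F that by auto
    then obtain d where d: "d > 0" "ball p d \<subseteq> - V" by (meson open_contains_ball)
    have "p \<in> S" "p - min d e < p" "p < p + min d e" using d that F assms(6) by auto
    then obtain x where "x \<in> U" "x \<in> S" "p - min d e < x" "x < p + min d e" "x \<noteq> p"
      by (rule limdenseD[OF U])
    moreover from this have "x \<in> ball p d" by (auto simp: dist_real_def)
    ultimately show ?thesis using d by (intro exI[of _ x]) auto
  qed
  obtain f where f: "\<And>p. p \<in> F \<Longrightarrow> f p \<in> X \<and> f p \<in> S \<and> f p \<notin> V \<and> f p \<noteq> p \<and> \<bar>f p - p\<bar> < e"
    using near[OF lim(1)] by metis
  obtain g where g: "\<And>p. p \<in> F \<Longrightarrow> g p \<in> Y \<and> g p \<in> S \<and> g p \<notin> V \<and> g p \<noteq> p \<and> \<bar>g p - p\<bar> < e"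
    using near[OF lim(2)] by metis
  define F' where "F' = F \<union> f ` F \<union> g ` F"
  have F': "finite F'" "F' \<subseteq> S" "F' \<inter> V = {}" "F \<subseteq> F'"
    using F f g by (auto simp: F'_def)
  then have "open (- F')" "b \<in> - F'"
    using assms(5) by (auto simp: finite_imp_closed)
  then obtain d where d: "d > 0" "cball b d \<subseteq> - F'" by (meson open_contains_cball)
  show ?thesis
  proof (rule that[of F' "V \<union> cball b d"])
    have "b \<in> interior (cball b d)" using d by (simp add: interior_cball)
    then show "b \<in> interior (V \<union> cball b d)"
      using interior_mono[of "cball b d" "V \<union> cball b d"] by blast
    show "\<forall>p\<in>F. \<exists>x\<in>X \<inter> F'. x \<noteq> p \<and> \<bar>x - p\<bar> < e"
      using f by (auto simp: F'_def)
    show "\<forall>p\<in>F. \<exists>x\<in>Y \<inter> F'. x \<noteq> p \<and> \<bar>x - p\<bar> < e"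
      using g by (auto simp: F'_def)
  qed (use F' V d in auto)
qed

text \<open>The stages of \<open>thin_step\<close> are iterated along an enumeration of
  \<open>B\<close>, and \<open>S'\<close> is the union of the finite sets. Promised points remain
  limits, since companions come ever closer; each point of \<open>B\<close> has a neighbourhood that
  is forbidden from some stage on, and it is disjoint from the earlier stages as well because these
  are contained in the later ones.\<close>

lemma exists_thin_subset:
  fixes S :: "real set"
  assumes lim: "limdense X S" "limdense Y S" and "s \<in> S" and B: "countable B" "B \<inter> S = {}"
  obtains S' where "S' \<subseteq> S" "s \<in> S'" "limdense X S'" "limdense Y S'" "closure S' \<inter> B = {}"
proof (cases "B = {}")
  \<comment> \<open>The enumeration \<open>from_nat_into\<close> is meaningful for nonempty sets
    only.\<close>
  case True
  then show ?thesis using that[of S] assms by auto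
next
  case False
  define b where "b = from_nat_into B"
  have b: "b n \<notin> S" for n
    using from_nat_into[OF False] B(2) by (auto simp: b_def)
  define P where "P n FV \<longleftrightarrow> finite (fst FV) \<and> fst FV \<subseteq> S \<and> fst FV \<inter> snd FV = {} \<and> closed (snd FV) \<and> s \<in> fst FV"
    for n :: nat and FV :: "real set \<times> real set"
  define R where "R n FV FV' \<longleftrightarrow> fst FV \<subseteq> fst FV' \<and> snd FV \<subseteq> snd FV' \<and> b n \<in> interior (snd FV') \<and>
    (\<forall>p\<in>fst FV. \<exists>x\<in>X \<inter> fst FV'. x \<noteq> p \<and> \<bar>x - p\<bar> < inverse (Suc n)) \<and>
    (\<forall>p\<in>fst FV. \<exists>x\<in>Y \<inter> fst FV'. x \<noteq> p \<and> \<bar>x - p\<bar> < inverse (Suc n))"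
    for n and FV FV' :: "real set \<times> real set"
  have "\<exists>FV. \<forall>n. P n (FV n) \<and> R n (FV n) (FV (Suc n))"
  proof (rule dependent_nat_choice)
    show "\<exists>FV. P 0 FV"
      using assms(3) by (intro exI[of _ "({s}, {})"]) (auto simp: P_def)
  next
    fix FV n assume FV: "P n FV"
    have e: "0 < inverse (real (Suc n))" by simp
    have FV': "finite (fst FV)" "fst FV \<subseteq> S" "fst FV \<inter> snd FV = {}" "closed (snd FV)"
      using FV by (simp_all add: P_def)
    obtain F' V' where F': "finite F'" "F' \<subseteq> S" "F' \<inter> V' = {}" "closed V'" "fst FV \<subseteq> F'" "snd FV \<subseteq> V'"
      "b n \<in> interior V'" "\<forall>p\<in>fst FV. \<exists>x\<in>X \<inter> F'. x \<noteq> p \<and> \<bar>x - p\<bar> < inverse (real (Suc n))"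
      "\<forall>p\<in>fst FV. \<exists>x\<in>Y \<inter> F'. x \<noteq> p \<and> \<bar>x - p\<bar> < inverse (real (Suc n))"
      by (rule thin_step[OF FV' b[of n] e lim])
    have "s \<in> F'" using FV F'(5) by (auto simp: P_def)
    then have "P (Suc n) (F', V')" "R n FV (F', V')"
      using F' by (simp_all only: P_def R_def fst_conv snd_conv simp_thms)
    then show "\<exists>FV'. P (Suc n) FV' \<and> R n FV FV'" by blast
  qed
  then obtain FV where "\<forall>n. P n (FV n) \<and> R n (FV n) (FV (Suc n))" ..
  then have FV: "P n (FV n)" "R n (FV n) (FV (Suc n))" for n by simp_all
  define F where "F n = fst (FV n)" for n
  define V where "V n = snd (FV n)" for n
  have F: "F n \<subseteq> S" "F n \<inter> V n = {}" "s \<in> F n" for n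
    using FV(1)[of n] by (auto simp: P_def F_def V_def)
  note R = FV(2)[unfolded R_def, folded F_def V_def]
  have monoF: "F m \<subseteq> F n" if "m \<le> n" for m n
    by (rule lift_Suc_mono_le[of F, OF _ that]) (rule R[THEN conjunct1])
  have monoV: "V m \<subseteq> V n" if "m \<le> n" for m n
    by (rule lift_Suc_mono_le[of V, OF _ that]) (rule R[THEN conjunct2, THEN conjunct1])
  have lim': "limdense U (\<Union>n. F n)"
    if U: "\<And>n. \<forall>p\<in>F n. \<exists>x\<in>U \<inter> F (Suc n). x \<noteq> p \<and> \<bar>x - p\<bar> < inverse (Suc n)" for U
    unfolding limdense_def
  proof (intro ballI allI impI)
    fix p a b assume "p \<in> (\<Union>n. F n)" and ab: "a < p \<and> p < b"
    then obtain n where n: "p \<in> F n" by blast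
    have "0 < min (p - a) (b - p)" using ab by simp
    then obtain m where m: "inverse (Suc m) < min (p - a) (b - p)"
      using reals_Archimedean by blast
    \<comment> \<open>At stage \<open>k\<close> the point \<open>p\<close> is already present and
      the companions are close enough.\<close>
    define k where "k = max n m"
    have "p \<in> F k" using n monoF[of n k] by (auto simp: k_def)
    then obtain x where x: "x \<in> U" "x \<in> F (Suc k)" "x \<noteq> p" "\<bar>x - p\<bar> < inverse (Suc k)"
      using U by blast
    have "inverse (Suc k) \<le> inverse (real (Suc m))"
      by (rule le_imp_inverse_le) (auto simp: k_def)
    then have "\<bar>x - p\<bar> < min (p - a) (b - p)" using x m by linarith
    then have "a < x" "x < b" by auto
    then show "\<exists>x. x \<in> U \<and> x \<in> (\<Union>n. F n) \<and> a < x \<and> x < b \<and> x \<noteq> p"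
      using x by blast
  qed
  show ?thesis
  proof (rule that[of "\<Union>n. F n"])
    show "(\<Union>n. F n) \<subseteq> S" "s \<in> (\<Union>n. F n)" using F by auto
    show "limdense X (\<Union>n. F n)"
      by (rule lim') (rule R[THEN conjunct2, THEN conjunct2, THEN conjunct2, THEN conjunct1])
    show "limdense Y (\<Union>n. F n)"
      by (rule lim') (rule R[THEN conjunct2, THEN conjunct2, THEN conjunct2, THEN conjunct2])
    have "x \<notin> closure (\<Union>n. F n)" if x: "x \<in> B" for x
    proof -
      obtain n where n: "b n = x"
        using from_nat_into_surj[OF B(1) x] by (auto simp: b_def)
      have "F m \<inter> V (Suc n) = {}" for m
        using F(2)[of "max m (Suc n)"] monoF[of m "max m (Suc n)"] monoV[of "Suc n" "max m (Suc n)"]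
        by auto
      then have "interior (V (Suc n)) \<inter> (\<Union>n. F n) = {}"
        using interior_subset[of "V (Suc n)"] by blast
      then have "interior (V (Suc n)) \<inter> closure (\<Union>n. F n) = {}"
        by (simp add: open_Int_closure_eq_empty)
      moreover have "x \<in> interior (V (Suc n))"
        using R[of n] n by simp
      ultimately show ?thesis by blast
    qed
    then show "closure (\<Union>n. F n) \<inter> B = {}" by blast
  qed
qed

section \<open>A colouring of the rationals with dense colour classes\<close>

lemma odd_int_between:
  fixes u v :: real
  assumes "u + 2 < v"
  obtains m :: int where "odd m" "u < m" "m < v"
proof (cases "odd (\<lfloor>u\<rfloor> + 1)")
  case True
  then show ?thesis using that[of "\<lfloor>u\<rfloor> + 1"] assms by linarith
next
  case False
  then have "odd (\<lfloor>u\<rfloor> + 2)" by simp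
  then show ?thesis using that[of "\<lfloor>u\<rfloor> + 2"] assms by linarith
qed

text \<open>The colour of \<open>m / 2 ^ k\<close> with \<open>m\<close> odd depends only on \<open>k\<close>, and every colour belongs to infinitely
  many \<open>k\<close>.\<close>

lemma exists_dense_colouring:
  obtains c :: "real \<Rightarrow> 'l::countable"
  where "\<And>l a b. a < b \<Longrightarrow> \<exists>x\<in>\<rat>. c x = l \<and> a < x \<and> x < b"
proof -
  \<comment> \<open>For \<open>x\<close> that is not a dyadic rational this is an unspecified
    number; all witnesses below are dyadic.\<close>
  define ex where "ex x = (LEAST k. x * 2 ^ k \<in> \<int>)" for x :: real
  have ex: "ex (of_int m / 2 ^ k) = k" if "odd m" for m :: int and k
    unfolding ex_def
  proof (rule Least_equality)
    fix j assume "real_of_int m / 2 ^ k * 2 ^ j \<in> \<int>"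
    then obtain i :: int where i: "real_of_int m / 2 ^ k * 2 ^ j = of_int i"
      by (auto elim: Ints_cases)
    show "k \<le> j"
    proof (rule ccontr)
      assume "\<not> k \<le> j"
      then obtain d where d: "k = j + Suc d"
        by (metis add_Suc_right less_imp_Suc_add not_le)
      have "real_of_int m = of_int i * 2 ^ Suc d"
        using i by (simp add: d power_add field_simps)
      also have "\<dots> = of_int (i * 2 ^ Suc d)" by simp
      finally have "m = i * 2 ^ Suc d" by (simp only: of_int_eq_iff)
      then show False using that by simp
    qed
  qed simp
  define c where "c x = (from_nat (fst (prod_decode (ex x))) :: 'l)" for x
  have "\<exists>x\<in>\<rat>. c x = l \<and> a < x \<and> x < b" if "a < b" for l a b
  proof -
    obtain j where j: "2 / (b - a) < 2 ^ j"
      using real_arch_pow[of 2 "2 / (b - a)"] by auto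
    \<comment> \<open>The exponent decodes to the colour \<open>l\<close> and is at least
      \<open>j\<close>, so that the odd multiples of \<open>1 / 2 ^ k\<close> are close enough to
      hit the interval.\<close>
    define k where "k = prod_encode (to_nat l, j)"
    have "(2::real) ^ j \<le> 2 ^ k"
      using le_prod_encode_2[of j "to_nat l"] by (intro power_increasing) (auto simp: k_def)
    then have "2 / (b - a) < 2 ^ k" using j by linarith
    then have "a * 2 ^ k + 2 < b * 2 ^ k" using \<open>a < b\<close> by (simp add: field_simps)
    then obtain m :: int where m: "odd m" "a * 2 ^ k < m" "m < b * 2 ^ k"
      using odd_int_between by blast
    define x where "x = real_of_int m / 2 ^ k"
    have "c x = l" using m ex by (simp add: c_def x_def k_def)
    moreover have "x \<in> \<rat>" by (simp add: x_def)
    moreover have "a < x" "x < b" using m by (simp_all add: x_def field_simps)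
    ultimately show ?thesis by blast
  qed
  then show ?thesis using that[of c] by blast
qed

section \<open>Tokens\<close>

datatype tree = Leaf | Node tree tree

instance tree :: countable
  by countable_datatype

text \<open>The definable substitute for relatedness of colours. For dense monochrome sets of
  rationals in a coding such an \<open>S\<close> exists if and only if their colours are
  related.\<close>

definition joined_in :: "real set set \<Rightarrow> real set \<Rightarrow> real set \<Rightarrow> real set \<Rightarrow> real \<Rightarrow> real \<Rightarrow> bool" where
  "joined_in F Q X Y a b \<longleftrightarrow> (\<exists>S\<in>F. S \<noteq> {} \<and> (\<forall>s\<in>S. a < s \<and> s < b \<and> (s \<in> X \<or> s \<in> Y)) \<and>
     limdense X S \<and> limdense Y S \<and> closure S \<inter> Q = {})"

definition joined :: "real set set \<Rightarrow> real set \<Rightarrow> real set \<Rightarrow> real set \<Rightarrow> bool" where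
  "joined F Q X Y \<longleftrightarrow> (\<forall>a b. a < b \<longrightarrow> joined_in F Q X Y a b)"

definition dense_in :: "real set \<Rightarrow> real \<Rightarrow> real \<Rightarrow> bool" where
  "dense_in X a b \<longleftrightarrow> (\<forall>p q. a \<le> p \<and> p < q \<and> q \<le> b \<longrightarrow> (\<exists>x\<in>X. p < x \<and> x < q))"

text \<open>The last condition excludes sets that are of more than one colour in every subinterval of some
  interval: such a set has two subsets, dense in some interval, that are not joined.\<close>

definition token :: "real set set \<Rightarrow> real set \<Rightarrow> real set \<Rightarrow> real set \<Rightarrow> bool" where
  "token F Q D X \<longleftrightarrow> X \<subseteq> D \<and> (\<forall>a b. a < b \<longrightarrow> (\<exists>x\<in>X. a < x \<and> x < b)) \<and>
     (\<forall>a b. a < b \<longrightarrow> (\<forall>X1\<in>F. \<forall>X2\<in>F. X1 \<subseteq> X \<and> X2 \<subseteq> X \<and> dense_in X1 a b \<and> dense_in X2 a b \<longrightarrow>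
        joined_in F Q X1 X2 a b))"

text \<open>This says that \<open>X - C\<close> is nowhere dense. It replaces membership of a value
  in a set when the value is a locally constant function.\<close>

definition nearly_in :: "real set \<Rightarrow> real set \<Rightarrow> bool" where
  "nearly_in C X \<longleftrightarrow> (\<forall>a b. a < b \<longrightarrow> (\<exists>p q. a \<le> p \<and> p < q \<and> q \<le> b \<and> (\<forall>x\<in>X. p < x \<and> x < q \<longrightarrow> x \<in> C)))"

text \<open>In a coding, \<open>V1\<close>, \<open>V2\<close> and \<open>V3\<close> carry the node
  in flavours 1, 2 and 3. The joins of \<open>X\<close> with \<open>V1\<close> and of
  \<open>Y\<close> with \<open>V2\<close> fix the left and the right child, and those with
  \<open>V3\<close> make all copies the same tree, including \<open>W\<close> in flavour 0.\<close>

definition pair :: "real set set \<Rightarrow> real set \<Rightarrow> (nat \<Rightarrow> real set) \<Rightarrow> real set \<Rightarrow> real set \<Rightarrow> real set \<Rightarrow> bool" where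
  "pair F Q D X Y W \<longleftrightarrow> (\<exists>V1\<in>F. \<exists>V2\<in>F. \<exists>V3\<in>F. token F Q (D 1) V1 \<and> token F Q (D 2) V2 \<and> token F Q (D 3) V3 \<and>
     joined F Q X V1 \<and> joined F Q Y V2 \<and> joined F Q V1 V3 \<and> joined F Q V2 V3 \<and> joined F Q W V3)"

text \<open>Colours are pairs of a flavour below 4 and a tree. A single symmetric relation cannot tell the two
  children of a node apart; so flavour 1 stands for a node seen from its left child, flavour 2 for a node
  seen from its right child, and flavour 3 identifies the copies of a tree in the flavours 0, 1 and 2.\<close>

fun arrow :: "nat \<times> tree \<Rightarrow> nat \<times> tree \<Rightarrow> bool" where
  "arrow (f, s) (g, t) \<longleftrightarrow> f = 0 \<and> g = 1 \<and> (\<exists>u. t = Node s u) \<or> f = 0 \<and> g = 2 \<and> (\<exists>u. t = Node u s) \<or>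
     f < 3 \<and> g = 3 \<and> s = t"

definition edge :: "nat \<times> tree \<Rightarrow> nat \<times> tree \<Rightarrow> bool" where
  "edge l l' \<longleftrightarrow> l = l' \<or> arrow l l' \<or> arrow l' l"

lemma edge_sym: "edge l l' \<Longrightarrow> edge l' l"
  by (auto simp: edge_def)

text \<open>Every arrow changes the flavour. Hence relatedness amounts to equality within a flavour,
  which is what keeps a token from mixing colours.\<close>

lemma edge_flavour: "edge l l' \<Longrightarrow> fst l = fst l' \<Longrightarrow> l = l'"
  by (cases l; cases l') (auto simp: edge_def)

section \<open>Monochrome intervals and intervals of density\<close>

definition monochrome :: "(real \<Rightarrow> 'l) \<Rightarrow> real set \<Rightarrow> real \<Rightarrow> real \<Rightarrow> 'l \<Rightarrow> bool" where
  "monochrome c X a b l \<longleftrightarrow> (\<forall>x\<in>X. a < x \<and> x < b \<longrightarrow> c x = l)"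

lemma monochrome_mono: "monochrome c X a b l \<Longrightarrow> a \<le> a' \<Longrightarrow> b' \<le> b \<Longrightarrow> monochrome c X a' b' l"
  by (force simp: monochrome_def)

lemma dense_in_mono: "dense_in X a b \<Longrightarrow> a \<le> a' \<Longrightarrow> b' \<le> b \<Longrightarrow> dense_in X a' b'"
  by (force simp: dense_in_def)

lemma joined_in_mono:
  assumes "joined_in F Q X Y a' b'" "a \<le> a'" "b' \<le> b"
  shows "joined_in F Q X Y a b"
proof -
  obtain S where "S \<in> F" "S \<noteq> {}" "\<forall>s\<in>S. a' < s \<and> s < b' \<and> (s \<in> X \<or> s \<in> Y)"
    "limdense X S" "limdense Y S" "closure S \<inter> Q = {}"
    using assms(1) by (auto simp: joined_in_def)
  moreover from this have "\<forall>s\<in>S. a < s \<and> s < b \<and> (s \<in> X \<or> s \<in> Y)"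
    using assms(2,3) by force
  ultimately show ?thesis unfolding joined_in_def by blast
qed

lemma limdense_interval:
  assumes "dense_in X a b" "X \<subseteq> Z"
  shows "limdense X (Z \<inter> {a<..<b})"
  unfolding limdense_def
proof (intro ballI allI impI)
  fix s p q assume s: "s \<in> Z \<inter> {a<..<b}" and pq: "p < s \<and> s < q"
  \<comment> \<open>Searching only to the left of \<open>s\<close> makes the point found different
    from \<open>s\<close>.\<close>
  then have "a \<le> max a p \<and> max a p < s \<and> s \<le> b" by auto
  then obtain x where "x \<in> X" "max a p < x" "x < s"
    using assms(1) unfolding dense_in_def by meson
  then show "\<exists>x. x \<in> X \<and> x \<in> Z \<inter> {a<..<b} \<and> p < x \<and> x < q \<and> x \<noteq> s"
    using s pq assms(2) by (intro exI[of _ x]) auto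
qed

text \<open>The interface to the construction of \<open>Q\<close> from CH. The family
  \<open>F\<close> is any family containing all sets of rationals, so that both ranges of the set
  quantifiers are instances.\<close>

locale coded =
  fixes F :: "real set set" and Q :: "real set" and c :: "real \<Rightarrow> nat \<times> tree"
  assumes Pow_Rats: "Pow \<rat> \<subseteq> F"
    and dense_colour: "\<And>l a b. a < b \<Longrightarrow> \<exists>x\<in>\<rat>. c x = l \<and> a < x \<and> x < b"
    and Q_Rats: "Q \<inter> \<rat> = {}"
    and Q_small: "\<And>Y l l'. Y \<subseteq> \<rat> \<Longrightarrow> edge l l' \<Longrightarrow> c ` (closure Y \<inter> \<rat>) \<subseteq> {l, l'} \<Longrightarrow>
        countable (closure Y \<inter> Q)"
    and Q_meets: "\<And>X. X \<subseteq> \<rat> \<Longrightarrow> X \<noteq> {} \<Longrightarrow> limdense X X \<Longrightarrow>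
        (\<And>l l'. edge l l' \<Longrightarrow> limdense {x. c x \<noteq> l \<and> c x \<noteq> l'} X) \<Longrightarrow> closure X \<inter> Q \<noteq> {}"
begin

definition D :: "nat \<Rightarrow> real set" where
  "D f = {x\<in>\<rat>. fst (c x) = f}"

lemma D_subset: "D f \<subseteq> \<rat>"
  by (auto simp: D_def)

lemma D_in_F: "X \<subseteq> D f \<Longrightarrow> X \<in> F"
  using D_subset Pow_Rats by blast

text \<open>Two thinnings of the union of \<open>X\<close> and \<open>Y\<close> within the interval.
  The first removes all rationals of other colours from the closure, which makes the set good and
  leaves only countably many points of \<open>Q\<close> in its closure; the second removes
  those.\<close>

lemma joined_in_edgeI:
  assumes X: "X \<subseteq> \<rat>" "dense_in X a b" "monochrome c X a b l" and Y: "Y \<subseteq> \<rat>"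
    "dense_in Y a b" "monochrome c Y a b l'"
    and "edge l l'" "a < b"
  shows "joined_in F Q X Y a b"
proof -
  let ?S = "(X \<union> Y) \<inter> {a<..<b}"
  let ?B = "{x\<in>\<rat>. c x \<notin> {l, l'}}"
  have "limdense X ?S" "limdense Y ?S"
    using X Y by (auto intro!: limdense_interval)
  moreover obtain s where "s \<in> X" "a < s" "s < b"
    using X(2) \<open>a < b\<close> by (force simp: dense_in_def)
  then have "s \<in> ?S" by auto
  moreover have "countable ?B"
    by (rule countable_subset[OF _ countable_rat]) auto
  moreover have "?B \<inter> ?S = {}"
    using X(3) Y(3) by (auto simp: monochrome_def)
  ultimately obtain S1 where S1: "S1 \<subseteq> ?S" "s \<in> S1" "limdense X S1" "limdense Y S1" "closure S1 \<inter> ?B = {}"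
    by (rule exists_thin_subset)
  have S1Q: "S1 \<subseteq> \<rat>" using S1(1) X(1) Y(1) by blast
  have "c ` (closure S1 \<inter> \<rat>) \<subseteq> {l, l'}"
    using S1(5) by blast
  then have "countable (closure S1 \<inter> Q)"
    by (rule Q_small[OF S1Q \<open>edge l l'\<close>])
  moreover have "closure S1 \<inter> Q \<inter> S1 = {}"
    using S1Q Q_Rats by blast
  ultimately obtain S2 where S2: "S2 \<subseteq> S1" "s \<in> S2" "limdense X S2" "limdense Y S2"
      "closure S2 \<inter> (closure S1 \<inter> Q) = {}"
    by (rule exists_thin_subset[OF S1(3,4,2)])
  have "closure S2 \<subseteq> closure S1" using S2(1) by (rule closure_mono)
  then have "closure S2 \<inter> Q = {}" using S2(5) by blast
  moreover have "S2 \<in> F" using S2(1) S1Q Pow_Rats by blast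
  moreover have "\<forall>s\<in>S2. a < s \<and> s < b \<and> (s \<in> X \<or> s \<in> Y)" using S2(1) S1(1) by auto
  ultimately show ?thesis
    using S2 unfolding joined_in_def by blast
qed

text \<open>Without related colours, the witness \<open>S\<close> would be bad: given related
  \<open>l\<close> and \<open>l'\<close>, the part of \<open>S\<close> in \<open>X\<close> or the
  part in \<open>Y\<close> is free of both, and it is dense in \<open>S\<close>. Then
  \<open>Q\<close> would meet the closure of \<open>S\<close>.\<close>

lemma joined_in_colours:
  assumes "joined_in F Q X Y a b" "X \<subseteq> \<rat>" "Y \<subseteq> \<rat>"
  shows "\<exists>x\<in>X. \<exists>y\<in>Y. a < x \<and> x < b \<and> a < y \<and> y < b \<and> edge (c x) (c y)"
proof (rule ccontr)
  assume neg: "\<not> ?thesis"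
  have no: "\<not> edge (c x) (c y)" if "x \<in> X" "a < x" "x < b" "y \<in> Y" "a < y" "y < b" for x y
    using neg that by blast
  obtain S where S: "S \<noteq> {}" "\<forall>s\<in>S. a < s \<and> s < b \<and> (s \<in> X \<or> s \<in> Y)"
    "limdense X S" "limdense Y S" "closure S \<inter> Q = {}"
    using assms(1) unfolding joined_in_def by (elim bexE conjE)
  have "closure S \<inter> Q \<noteq> {}"
  proof (rule Q_meets)
    show "S \<subseteq> \<rat>" using S(2) assms(2,3) by blast
    show "limdense S S" by (rule limdense_mono[OF S(3)]) auto
    fix l l' assume "edge l l'"
    show "limdense {x. c x \<noteq> l \<and> c x \<noteq> l'} S"
    proof (cases "\<exists>x\<in>X \<inter> S. c x \<in> {l, l'}")
      case True
      then obtain x where x: "x \<in> X" "x \<in> S" "c x = l \<or> c x = l'" by auto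
      have "c y \<noteq> l \<and> c y \<noteq> l'" if y: "y \<in> Y \<inter> S" for y
        using no[of x y] x y S(2) \<open>edge l l'\<close> edge_sym[OF \<open>edge l l'\<close>] by (auto simp: edge_def)
      then show ?thesis by (intro limdense_mono[OF S(4)]) auto
    next
      case False
      then show ?thesis by (intro limdense_mono[OF S(3)]) auto
    qed
  qed (fact S(1))
  then show False using S(5) by simp
qed

lemma joined_in_edgeD:
  assumes "joined_in F Q X Y a b" "X \<subseteq> \<rat>" "Y \<subseteq> \<rat>" "monochrome c X a b l" "monochrome c Y a b l'"
  shows "edge l l'"
  using joined_in_colours[OF assms(1-3)] assms(4,5) unfolding monochrome_def by metis

text \<open>Points of pairwise distinct colours are picked from the rational intervals in turn, two from each
  interval.\<close>

lemma split_colours: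
  assumes X: "dense_in X a b" and "a < b"
    and nowhere: "\<And>l p q. a \<le> p \<Longrightarrow> p < q \<Longrightarrow> q \<le> b \<Longrightarrow>
      \<exists>p' q'. p \<le> p' \<and> p' < q' \<and> q' \<le> q \<and> (\<forall>x\<in>X. p' < x \<and> x < q' \<longrightarrow> c x \<noteq> l)"
  obtains X1 X2 where "X1 \<subseteq> X" "X2 \<subseteq> X" "dense_in X1 a b" "dense_in X2 a b"
    "\<forall>x\<in>X1. \<forall>y\<in>X2. c x \<noteq> c y"
proof -
  have avoid: "\<exists>x\<in>X. p < x \<and> x < q \<and> c x \<notin> A"
    if fin: "finite A" and pq: "a \<le> p" "p < q" "q \<le> b" for A p q
  proof -
    \<comment> \<open>The finitely many colours are excluded one after the other, each by shrinking
      the interval.\<close>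
    have "\<exists>p' q'. p \<le> p' \<and> p' < q' \<and> q' \<le> q \<and> (\<forall>x\<in>X. p' < x \<and> x < q' \<longrightarrow> c x \<notin> A)"
      using fin
    proof (induction A)
      case empty
      show ?case using pq by (intro exI[of _ p] exI[of _ q]) auto
    next
      case (insert l A)
      then obtain p' q' where 1: "p \<le> p'" "p' < q'" "q' \<le> q" "\<forall>x\<in>X. p' < x \<and> x < q' \<longrightarrow> c x \<notin> A"
        by blast
      then obtain p'' q'' where 2: "p' \<le> p''" "p'' < q''" "q'' \<le> q'" "\<forall>x\<in>X. p'' < x \<and> x < q'' \<longrightarrow> c x \<noteq> l"
        using nowhere[of p' q' l] pq by auto
      show ?case
      proof (intro exI conjI)
        show "p \<le> p''" "p'' < q''" "q'' \<le> q" using 1 2 by auto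
        show "\<forall>x\<in>X. p'' < x \<and> x < q'' \<longrightarrow> c x \<notin> insert l A" using 1 2 by force
      qed
    qed
    then obtain p' q' where 1: "p \<le> p'" "p' < q'" "q' \<le> q" "\<forall>x\<in>X. p' < x \<and> x < q' \<longrightarrow> c x \<notin> A"
      by blast
    then have "a \<le> p' \<and> p' < q' \<and> q' \<le> b" using pq by auto
    then obtain x where "x \<in> X" "p' < x" "x < q'" using X unfolding dense_in_def by meson
    then show ?thesis using 1 by force
  qed
  define A where "A = {(p, q). p \<in> \<rat> \<and> q \<in> \<rat> \<and> a \<le> p \<and> p < q \<and> q \<le> b}"
  have Aex: "\<exists>(p', q')\<in>A. p \<le> p' \<and> q' \<le> q" if pq: "a \<le> p" "p < q" "q \<le> b" for p q
  proof -
    obtain p' where "p' \<in> \<rat>" "p < p'" "p' < q" using Rats_dense_in_real[OF pq(2)] by auto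
    moreover from this obtain q' where "q' \<in> \<rat>" "p' < q'" "q' < q" using Rats_dense_in_real by blast
    ultimately show ?thesis using pq by (intro bexI[of _ "(p', q')"]) (auto simp: A_def)
  qed
  have "A \<noteq> {}" using Aex[of a b] \<open>a < b\<close> by auto
  moreover have "countable A"
    by (rule countable_subset[of _ "\<rat> \<times> \<rat>"]) (auto simp: A_def countable_rat)
  ultimately have I: "range (from_nat_into A) = A"
    by (rule range_from_nat_into)
  define I where "I = from_nat_into A"
  note I = I[folded I_def]
  have IA: "a \<le> fst (I n) \<and> fst (I n) < snd (I n) \<and> snd (I n) \<le> b" for n
  proof -
    have "I n \<in> A" using I by blast
    then show ?thesis by (auto simp: A_def)
  qed
  have "\<exists>z. \<forall>n. z n \<in> X \<and> fst (I (n div 2)) < z n \<and> z n < snd (I (n div 2)) \<and> c (z n) \<notin> c ` z ` {..<n}"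
  proof (rule dependent_wellorder_choice)
    fix r f g and n :: nat
    assume "\<And>m. m < n \<Longrightarrow> f m = (g m :: real)"
    then have "f ` {..<n} = g ` {..<n}" by (intro image_cong) auto
    then show "(r \<in> X \<and> fst (I (n div 2)) < r \<and> r < snd (I (n div 2)) \<and> c r \<notin> c ` f ` {..<n}) =
      (r \<in> X \<and> fst (I (n div 2)) < r \<and> r < snd (I (n div 2)) \<and> c r \<notin> c ` g ` {..<n})" by simp
  next
    fix n :: nat and f :: "nat \<Rightarrow> real"
    show "\<exists>r. r \<in> X \<and> fst (I (n div 2)) < r \<and> r < snd (I (n div 2)) \<and> c r \<notin> c ` f ` {..<n}"
      using avoid[of "c ` f ` {..<n}" "fst (I (n div 2))" "snd (I (n div 2))"] IA[of "n div 2"] by auto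
  qed
  then obtain z where z: "\<And>n. z n \<in> X" "\<And>n. fst (I (n div 2)) < z n" "\<And>n. z n < snd (I (n div 2))"
    "\<And>n. c (z n) \<notin> c ` z ` {..<n}" by blast
  have inj: "c (z m) \<noteq> c (z n)" if "m \<noteq> n" for m n
    using that z(4)[of m] z(4)[of n] by (metis imageI lessThan_iff linorder_neqE_nat)
  have dense_in: "dense_in (range (\<lambda>n. z (2 * n + i))) a b" if "i < 2" for i
    unfolding dense_in_def
  proof (intro allI impI)
    fix p q assume "a \<le> p \<and> p < q \<and> q \<le> b"
    then obtain n where "p \<le> fst (I n)" "snd (I n) \<le> q"
      using Aex[of p q] I by (auto simp: split_beta)
    moreover have "(2 * n + i) div 2 = n" using that by simp
    ultimately have "p < z (2 * n + i) \<and> z (2 * n + i) < q"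
      using z(2)[of "2 * n + i"] z(3)[of "2 * n + i"] by auto
    then show "\<exists>x\<in>range (\<lambda>n. z (2 * n + i)). p < x \<and> x < q" by blast
  qed
  show ?thesis
  proof (rule that[OF _ _ dense_in[of 0] dense_in[of 1]])
    have "c (z (2 * m + 0)) \<noteq> c (z (2 * n + 1))" for m n
      by (rule inj) presburger
    then show "\<forall>x\<in>range (\<lambda>n. z (2 * n + 0)). \<forall>y\<in>range (\<lambda>n. z (2 * n + 1)). c x \<noteq> c y"
      by blast
  qed (use z in auto)
qed

text \<open>Two subsets of a token without common colour cannot be dense in the same interval: they
  would be joined, hence contain related colours, and these coincide within one flavour. In an
  interval without monochrome subintervals such subsets exist: either some colour is dense in a
  subinterval and is separated from the rest there, or every colour is nowhere dense and
  \<open>split_colours\<close> applies.\<close>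

lemma token_monochrome:
  assumes token: "token F Q (D f) X" and "a < b"
  obtains a' b' t where "a \<le> a'" "a' < b'" "b' \<le> b" "monochrome c X a' b' (f, t)"
proof -
  have XD: "X \<subseteq> D f" using token by (simp add: token_def)
  have Xdense: "dense_in X a b" for a b
    using token by (auto simp: token_def dense_in_def)
  have split: False if "X1 \<subseteq> X" "X2 \<subseteq> X" "dense_in X1 p q" "dense_in X2 p q" "p < q"
    "\<And>x y. x \<in> X1 \<Longrightarrow> y \<in> X2 \<Longrightarrow> c x \<noteq> c y" for X1 X2 p q
  proof -
    have "X1 \<subseteq> \<rat>" "X2 \<subseteq> \<rat>" using that XD D_subset by blast+
    moreover have "joined_in F Q X1 X2 p q"
      using token that D_in_F[of X1 f] D_in_F[of X2 f] XD unfolding token_def by blast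
    ultimately obtain x y where xy: "x \<in> X1" "y \<in> X2" "edge (c x) (c y)"
      using joined_in_colours by blast
    moreover have "fst (c x) = fst (c y)"
      using xy that(1,2) XD by (auto simp: D_def)
    ultimately show False using edge_flavour that(6) by blast
  qed
  have "\<exists>a' b' l. a \<le> a' \<and> a' < b' \<and> b' \<le> b \<and> monochrome c X a' b' l"
  proof (rule ccontr)
    assume "\<not> ?thesis"
    then have nohom: "\<not> monochrome c X a' b' l" if "a \<le> a'" "a' < b'" "b' \<le> b" for a' b' l
      using that by blast
    have nowhere: "\<exists>p' q'. p \<le> p' \<and> p' < q' \<and> q' \<le> q \<and> (\<forall>x\<in>X. p' < x \<and> x < q' \<longrightarrow> c x \<noteq> l)"
      if pq: "a \<le> p" "p < q" "q \<le> b" for l p q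
    proof (rule ccontr)
      assume "\<not> ?thesis"
      then have "dense_in {x\<in>X. c x = l} p q" unfolding dense_in_def by auto
      moreover have "dense_in {x\<in>X. c x \<noteq> l} p q"
        using nohom[of _ _ l] pq unfolding dense_in_def monochrome_def by (metis (mono_tags, lifting) mem_Collect_eq order_trans)
      ultimately show False
        using split[of "{x\<in>X. c x = l}" "{x\<in>X. c x \<noteq> l}" p q] pq(2) by auto
    qed
    obtain X1 X2 where "X1 \<subseteq> X" "X2 \<subseteq> X" "dense_in X1 a b" "dense_in X2 a b"
      "\<forall>x\<in>X1. \<forall>y\<in>X2. c x \<noteq> c y"
      by (rule split_colours[OF Xdense \<open>a < b\<close> nowhere])
    then show False using split \<open>a < b\<close> by blast
  qed
  then obtain a' b' l where h: "a \<le> a'" "a' < b'" "b' \<le> b" "monochrome c X a' b' l" by blast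
  obtain x where "x \<in> X" "a' < x" "x < b'"
    using Xdense[of a' b'] h(2) by (force simp: dense_in_def)
  then have "fst l = f" using h(4) XD by (auto simp: monochrome_def D_def)
  then show ?thesis using that[of a' b' "snd l"] h by auto
qed

section \<open>Gluing and pairing of tokens\<close>

lemma token_dense: "token F Q U X \<Longrightarrow> dense_in X a b"
  by (auto simp: token_def dense_in_def)

lemma token_Rats: "token F Q (D f) X \<Longrightarrow> X \<subseteq> \<rat>"
  using D_subset by (auto simp: token_def)

lemma token_point:
  assumes "token F Q U X" "a < b"
  obtains x where "x \<in> X" "a < x" "x < b"
  using assms unfolding token_def by blast

text \<open>Read \<open>R a b t\<close> as prescribing the value \<open>t\<close> on the interval
  from \<open>a\<close> to \<open>b\<close>. If prescriptions agree on overlaps and occur within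
  every interval, the rationals that have the prescribed colour form a token of any desired
  flavour.\<close>

lemma token_glue:
  fixes R :: "real \<Rightarrow> real \<Rightarrow> tree \<Rightarrow> bool"
  assumes ex: "\<And>a b. a < b \<Longrightarrow> \<exists>a' b' t. a \<le> a' \<and> a' < b' \<and> b' \<le> b \<and> R a' b' t"
    and uniq: "\<And>a b t a' b' t'. R a b t \<Longrightarrow> R a' b' t' \<Longrightarrow> max a a' < min b b' \<Longrightarrow> t = t'"
  obtains W where "token F Q (D f) W" "\<forall>a b t. R a b t \<longrightarrow> monochrome c W a b (f, t)"
proof -
  define W where "W = {d\<in>\<rat>. \<exists>a b t. R a b t \<and> a < d \<and> d < b \<and> c d = (f, t)}"
  have WD: "W \<subseteq> D f" by (auto simp: W_def D_def)
  have monochrome: "monochrome c W a b (f, t)" if "R a b t" for a b t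
    unfolding monochrome_def
  proof (intro ballI impI)
    fix d assume "d \<in> W" and d: "a < d \<and> d < b"
    then obtain a' b' t' where "R a' b' t'" "a' < d" "d < b'" "c d = (f, t')" by (auto simp: W_def)
    then show "c d = (f, t)" using uniq[OF that, of a' b' t'] d by auto
  qed
  have dense: "\<exists>x\<in>W. a < x \<and> x < b" if ab: "a < b" for a b
  proof -
    obtain a' b' t where 1: "a \<le> a'" "a' < b'" "b' \<le> b" "R a' b' t" using ex[OF ab] by blast
    obtain x where x: "x \<in> \<rat>" "c x = (f, t)" "a' < x" "x < b'" using dense_colour[OF 1(2)] by blast
    then have "x \<in> W" using 1 by (auto simp: W_def)
    then show ?thesis using x 1 by force
  qed
  have "joined_in F Q X1 X2 a b"
    if X: "X1 \<subseteq> W" "X2 \<subseteq> W" "dense_in X1 a b" "dense_in X2 a b" and "a < b" for X1 X2 a b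
  proof -
    obtain a' b' t where 1: "a \<le> a'" "a' < b'" "b' \<le> b" "R a' b' t" using ex[OF \<open>a < b\<close>] by blast
    have "joined_in F Q X1 X2 a' b'"
    proof (rule joined_in_edgeI)
      show "X1 \<subseteq> \<rat>" "X2 \<subseteq> \<rat>" using X WD D_subset by blast+
      show "dense_in X1 a' b'" "dense_in X2 a' b'" using X 1 dense_in_mono by blast+
      show "monochrome c X1 a' b' (f, t)" "monochrome c X2 a' b' (f, t)"
        using monochrome[OF 1(4)] X by (auto simp: monochrome_def)
    qed (use 1 in \<open>auto simp: edge_def\<close>)
    then show ?thesis using joined_in_mono 1 by blast
  qed
  then have "token F Q (D f) W"
    using WD dense unfolding token_def by blast
  then show ?thesis using that monochrome by blast
qed

lemma joined_edgeI:
  assumes X: "token F Q (D f) X" and Y: "token F Q (D g) Y"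
    and ex: "\<And>a b. a < b \<Longrightarrow> \<exists>a' b' s t. a \<le> a' \<and> a' < b' \<and> b' \<le> b \<and> monochrome c X a' b' s \<and> monochrome c Y a' b' t \<and> edge s t"
  shows "joined F Q X Y"
  unfolding joined_def
proof (intro allI impI)
  fix a b :: real assume "a < b"
  then obtain a' b' s t where 1: "a \<le> a'" "a' < b'" "b' \<le> b" "monochrome c X a' b' s"
    "monochrome c Y a' b' t" "edge s t"
    using ex by blast
  have "joined_in F Q X Y a' b'"
    using joined_in_edgeI[OF token_Rats[OF X] token_dense[OF X] 1(4) token_Rats[OF Y] token_dense[OF Y] 1(5,6,2)] .
  then show "joined_in F Q X Y a b" using joined_in_mono 1 by blast
qed

text \<open>On intervals where both \<open>X\<close> and \<open>Y\<close> are monochrome the value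
  of the pair is determined; gluing these values in each of the four flavours gives \<open>W\<close>
  and the three auxiliary tokens.\<close>

lemma exists_pair:
  assumes X: "token F Q (D 0) X" and Y: "token F Q (D 0) Y"
  obtains W where "token F Q (D 0) W" "pair F Q D X Y W"
proof -
  define R where "R a b w \<longleftrightarrow> (\<exists>s t. monochrome c X a b (0, s) \<and> monochrome c Y a b (0, t) \<and> w = Node s t)" for a b w
  have ex: "\<exists>a' b' t. a \<le> a' \<and> a' < b' \<and> b' \<le> b \<and> R a' b' t" if "a < b" for a b
  proof -
    obtain a' b' s where 1: "a \<le> a'" "a' < b'" "b' \<le> b" "monochrome c X a' b' (0, s)"
      using token_monochrome[OF X \<open>a < b\<close>] .
    obtain a'' b'' t where 2: "a' \<le> a''" "a'' < b''" "b'' \<le> b'" "monochrome c Y a'' b'' (0, t)"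
      using token_monochrome[OF Y \<open>a' < b'\<close>] .
    have "monochrome c X a'' b'' (0, s)" by (rule monochrome_mono[OF 1(4) 2(1,3)])
    then have "R a'' b'' (Node s t)" using 2 by (auto simp: R_def)
    moreover have "a \<le> a''" "b'' \<le> b" using 1 2 by auto
    ultimately show ?thesis using 2 by blast
  qed
  have uniq: "w = w'" if R: "R a b w" "R a' b' w'" and o: "max a a' < min b b'" for a b w a' b' w'
  proof -
    obtain x where "x \<in> X" "max a a' < x" "x < min b b'" using token_point[OF X o] .
    moreover obtain y where "y \<in> Y" "max a a' < y" "y < min b b'" using token_point[OF Y o] .
    ultimately show ?thesis using R by (auto simp: R_def monochrome_def)
  qed
  obtain W where W: "token F Q (D 0) W" "\<forall>a b t. R a b t \<longrightarrow> monochrome c W a b (0, t)"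
    by (rule token_glue[of R 0, OF ex uniq])
  obtain V1 where V1: "token F Q (D 1) V1" "\<forall>a b t. R a b t \<longrightarrow> monochrome c V1 a b (1, t)"
    by (rule token_glue[of R 1, OF ex uniq])
  obtain V2 where V2: "token F Q (D 2) V2" "\<forall>a b t. R a b t \<longrightarrow> monochrome c V2 a b (2, t)"
    by (rule token_glue[of R 2, OF ex uniq])
  obtain V3 where V3: "token F Q (D 3) V3" "\<forall>a b t. R a b t \<longrightarrow> monochrome c V3 a b (3, t)"
    by (rule token_glue[of R 3, OF ex uniq])
  have edges: "edge (0, s) (1, Node s t)" "edge (0, t) (2, Node s t)" "edge (1, t) (3, t)" "edge (2, t) (3, t)"
    "edge (0, t) (3, t)" for s t
    by (auto simp: edge_def)
  have "joined F Q X V1"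
    by (rule joined_edgeI[OF X V1(1)]) (metis R_def V1(2) edges(1) ex)
  moreover have "joined F Q Y V2"
    by (rule joined_edgeI[OF Y V2(1)]) (metis R_def V2(2) edges(2) ex)
  moreover have "joined F Q V1 V3"
    by (rule joined_edgeI[OF V1(1) V3(1)]) (metis V1(2) V3(2) edges(3) ex)
  moreover have "joined F Q V2 V3"
    by (rule joined_edgeI[OF V2(1) V3(1)]) (metis V2(2) V3(2) edges(4) ex)
  moreover have "joined F Q W V3"
    by (rule joined_edgeI[OF W(1) V3(1)]) (metis W(2) V3(2) edges(5) ex)
  moreover have "V1 \<in> F" "V2 \<in> F" "V3 \<in> F"
    using V1(1) V2(1) V3(1) D_in_F by (auto simp: token_def)
  ultimately have "pair F Q D X Y W"
    using V1(1) V2(1) V3(1) unfolding pair_def by blast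
  then show ?thesis using that W(1) by blast
qed

text \<open>The interval is shrunk until the three auxiliary tokens are monochrome too. Then every
  join becomes an \<open>edge\<close> between known flavours, and the five edges determine the
  node.\<close>

lemma pair_monochrome:
  assumes X: "token F Q (D 0) X" and Y: "token F Q (D 0) Y" and W: "token F Q (D 0) W"
    and pair: "pair F Q D X Y W" and h: "monochrome c X a b (0, s)"
      "monochrome c Y a b (0, t)" "monochrome c W a b (0, w)"
    and "a < b"
  shows "w = Node s t"
proof -
  obtain V1 V2 V3 where V: "token F Q (D 1) V1" "token F Q (D 2) V2" "token F Q (D 3) V3"
    and J: "joined F Q X V1" "joined F Q Y V2" "joined F Q V1 V3" "joined F Q V2 V3" "joined F Q W V3"
    using pair by (auto simp: pair_def)
  obtain a1 b1 v1 where 1: "a \<le> a1" "a1 < b1" "b1 \<le> b" "monochrome c V1 a1 b1 (1, v1)"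
    using token_monochrome[OF V(1) \<open>a < b\<close>] .
  obtain a2 b2 v2 where 2: "a1 \<le> a2" "a2 < b2" "b2 \<le> b1" "monochrome c V2 a2 b2 (2, v2)"
    using token_monochrome[OF V(2) \<open>a1 < b1\<close>] .
  obtain a3 b3 v3 where 3: "a2 \<le> a3" "a3 < b3" "b3 \<le> b2" "monochrome c V3 a3 b3 (3, v3)"
    using token_monochrome[OF V(3) \<open>a2 < b2\<close>] .
  have le: "a \<le> a3" "b3 \<le> b" "a1 \<le> a3" "b3 \<le> b1" using 1 2 3 by auto
  note h' = h[THEN monochrome_mono, OF le(1,2)] monochrome_mono[OF 1(4) le(3,4)] monochrome_mono[OF 2(4) 3(1,3)] 3(4)
  note J' = J[unfolded joined_def, rule_format, OF 3(2)]
  note rat = X[THEN token_Rats] Y[THEN token_Rats] W[THEN token_Rats] V[THEN token_Rats]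
  have "edge (0, s) (1, v1)" by (rule joined_in_edgeD[OF J'(1) rat(1,4) h'(1,4)])
  moreover have "edge (0, t) (2, v2)" by (rule joined_in_edgeD[OF J'(2) rat(2,5) h'(2,5)])
  moreover have "edge (1, v1) (3, v3)" by (rule joined_in_edgeD[OF J'(3) rat(4,6) h'(4,6)])
  moreover have "edge (2, v2) (3, v3)" by (rule joined_in_edgeD[OF J'(4) rat(5,6) h'(5,6)])
  moreover have "edge (0, w) (3, v3)" by (rule joined_in_edgeD[OF J'(5) rat(3,6) h'(3,6)])
  ultimately show ?thesis by (auto simp: edge_def)
qed

text \<open>These are the constant tokens; the one of \<open>Leaf\<close> in flavour 0 serves as
  zero.\<close>

lemma token_colour_class: "token F Q (D f) {x\<in>\<rat>. c x = (f, t)}"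
proof -
  have "joined_in F Q X1 X2 a b" if "X1 \<subseteq> {x\<in>\<rat>. c x = (f, t)}" "X2 \<subseteq> {x\<in>\<rat>. c x = (f, t)}"
    "dense_in X1 a b" "dense_in X2 a b" "a < b" for X1 X2 a b
    by (rule joined_in_edgeI[of _ _ _ "(f, t)" _ "(f, t)"]) (use that in \<open>auto simp: monochrome_def edge_def\<close>)
  moreover have "{x\<in>\<rat>. c x = (f, t)} \<subseteq> D f" by (auto simp: D_def)
  moreover have "\<exists>x\<in>{x\<in>\<rat>. c x = (f, t)}. a < x \<and> x < b" if "a < b" for a b
    using dense_colour[OF that, of "(f, t)"] by auto
  ultimately show ?thesis unfolding token_def by simp
qed

lemma nearly_in_monochrome:
  assumes "token F Q (D 0) X" "monochrome c X a b (0, s)" "a < b" "nearly_in {x\<in>\<rat>. c x \<in> Pair 0 ` A} X"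
  shows "s \<in> A"
proof -
  obtain p q where "a \<le> p" "p < q" "q \<le> b" "\<forall>x\<in>X. p < x \<and> x < q \<longrightarrow> x \<in> {x\<in>\<rat>. c x \<in> Pair 0 ` A}"
    using assms(3,4) unfolding nearly_in_def by blast
  moreover from this obtain x where "x \<in> X" "p < x" "x < q" using token_point[OF assms(1)] by metis
  ultimately have "c x = (0, s)" "c x \<in> Pair 0 ` A" using assms(2) by (force simp: monochrome_def)+
  then show ?thesis by auto
qed

lemma nearly_in_I:
  assumes X: "token F Q (D 0) X"
    and ex: "\<And>a b. a < b \<Longrightarrow> \<exists>a' b' s. a \<le> a' \<and> a' < b' \<and> b' \<le> b \<and> monochrome c X a' b' (0, s) \<and> s \<in> A"
  shows "nearly_in {x\<in>\<rat>. c x \<in> Pair 0 ` A} X"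
  unfolding nearly_in_def
proof (intro allI impI)
  fix a b :: real assume "a < b"
  then obtain a' b' s where 1: "a \<le> a'" "a' < b'" "b' \<le> b" "monochrome c X a' b' (0, s)" "s \<in> A"
    using ex by blast
  have "\<forall>x\<in>X. a' < x \<and> x < b' \<longrightarrow> x \<in> {x\<in>\<rat>. c x \<in> Pair 0 ` A}"
    using 1(4,5) token_Rats[OF X] by (auto simp: monochrome_def)
  then show "\<exists>p q. a \<le> p \<and> p < q \<and> q \<le> b \<and> (\<forall>x\<in>X. p < x \<and> x < q \<longrightarrow> x \<in> {x\<in>\<rat>. c x \<in> Pair 0 ` A})"
    using 1 by blast
qed

end

lemma exists_coded:
  assumes "continuum_hypothesis" "Pow \<rat> \<subseteq> F"
  obtains Q c where "coded F Q c"
proof -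
  obtain c :: "real \<Rightarrow> nat \<times> tree" where c: "\<And>l a b. a < b \<Longrightarrow> \<exists>x\<in>\<rat>. c x = l \<and> a < x \<and> x < b"
    using exists_dense_colouring by blast
  obtain Q where Q: "Q \<inter> \<rat> = {}"
    "\<And>Y l l'. Y \<subseteq> \<rat> \<Longrightarrow> edge l l' \<Longrightarrow> c ` (closure Y \<inter> \<rat>) \<subseteq> {l, l'} \<Longrightarrow> countable (closure Y \<inter> Q)"
    "\<And>X. X \<subseteq> \<rat> \<Longrightarrow> X \<noteq> {} \<Longrightarrow> limdense X X \<Longrightarrow>
        (\<And>l l'. edge l l' \<Longrightarrow> limdense {x. c x \<noteq> l \<and> c x \<noteq> l'} X) \<Longrightarrow> closure X \<inter> Q \<noteq> {}"
    by (rule exists_separating_set[OF assms(1) subset_refl, of edge c]) blast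
  have "coded F Q c"
    by unfold_locales (fact assms(2) c Q)+
  then show ?thesis using that by blast
qed

section \<open>Recursive programs as Horn clauses over binary trees\<close>

datatype tm = Var nat | Lf | Nd tm tm

primrec eval_tm :: "(nat \<Rightarrow> tree) \<Rightarrow> tm \<Rightarrow> tree" where
  "eval_tm \<sigma> (Var i) = \<sigma> i"
| "eval_tm \<sigma> Lf = Leaf"
| "eval_tm \<sigma> (Nd s t) = Node (eval_tm \<sigma> s) (eval_tm \<sigma> t)"

primrec tm_vars :: "tm \<Rightarrow> nat set" where
  "tm_vars (Var i) = {i}"
| "tm_vars Lf = {}"
| "tm_vars (Nd s t) = tm_vars s \<union> tm_vars t"

primrec tm_of :: "tree \<Rightarrow> tm" where
  "tm_of Leaf = Lf"
| "tm_of (Node s t) = Nd (tm_of s) (tm_of t)"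

lemma eval_tm_tm_of [simp]: "eval_tm \<sigma> (tm_of t) = t"
  by (induction t) auto

lemma tm_vars_tm_of [simp]: "tm_vars (tm_of t) = {}"
  by (induction t) auto

section \<open>Programs and their data as trees\<close>

primrec nat_tree :: "nat \<Rightarrow> tree" where
  "nat_tree 0 = Leaf"
| "nat_tree (Suc n) = Node Leaf (nat_tree n)"

primrec list_tree :: "tree list \<Rightarrow> tree" where
  "list_tree [] = Leaf"
| "list_tree (x # xs) = Node x (list_tree xs)"

abbreviation nats_tree :: "nat list \<Rightarrow> tree" where
  "nats_tree xs \<equiv> list_tree (map nat_tree xs)"

lemma nat_tree_inject [simp]: "nat_tree m = nat_tree n \<longleftrightarrow> m = n"
proof (induction m arbitrary: n)
  case 0
  then show ?case by (cases n) auto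
next
  case (Suc m)
  then show ?case by (cases n) auto
qed

lemma list_tree_inject [simp]: "list_tree xs = list_tree ys \<longleftrightarrow> xs = ys"
proof (induction xs arbitrary: ys)
  case Nil
  then show ?case by (cases ys) auto
next
  case (Cons x xs)
  then show ?case by (cases ys) auto
qed

text \<open>An opaque name for numerals used as labels: they are compared by
  \<open>tag_inject\<close> instead of being unfolded into nodes.\<close>

definition tag :: "nat \<Rightarrow> tree" where
  "tag k = nat_tree k"

lemma tag_inject [simp]: "tag m = tag n \<longleftrightarrow> m = n"
  by (simp add: tag_def)

primrec recf_tree :: "recf \<Rightarrow> tree" where
  "recf_tree Zero = Node (tag 0) Leaf"
| "recf_tree Succ = Node (tag 6) Leaf"
| "recf_tree (Proj i) = Node (tag 2) (nat_tree i)"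
| "recf_tree (Comp f gs) = Node (tag 3) (Node (recf_tree f) (list_tree (map recf_tree gs)))"
| "recf_tree (PrimRec f g) = Node (tag 4) (Node (recf_tree f) (recf_tree g))"
| "recf_tree (Minim f) = Node (tag 5) (recf_tree f)"

lemma recf_tree_eq_tag:
  "recf_tree f = Node (tag 0) a \<longleftrightarrow> f = Zero \<and> a = Leaf"
  "recf_tree f = Node (tag 6) a \<longleftrightarrow> f = Succ \<and> a = Leaf"
  "recf_tree f = Node (tag 2) a \<longleftrightarrow> (\<exists>i. f = Proj i \<and> a = nat_tree i)"
  "recf_tree f = Node (tag 3) (Node a b) \<longleftrightarrow> (\<exists>f' gs. f = Comp f' gs \<and> a = recf_tree f' \<and> b = list_tree (map recf_tree gs))"
  "recf_tree f = Node (tag 4) (Node a b) \<longleftrightarrow> (\<exists>f' g. f = PrimRec f' g \<and> a = recf_tree f' \<and> b = recf_tree g)"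
  "recf_tree f = Node (tag 5) a \<longleftrightarrow> (\<exists>f'. f = Minim f' \<and> a = recf_tree f')"
  by (cases f; auto)+

lemma recf_tree_inject: "recf_tree f = recf_tree g \<Longrightarrow> f = g"
proof (induction f arbitrary: g)
  case (Comp f gs)
  then obtain f' gs' where g: "g = Comp f' gs'" "recf_tree f = recf_tree f'" "map recf_tree gs = map recf_tree gs'"
    by (cases g) auto
  then have len: "length gs = length gs'" by (metis length_map)
  have "gs = gs'"
  proof (rule nth_equalityI[OF len])
    fix i assume i: "i < length gs"
    then have "recf_tree (gs ! i) = recf_tree (gs' ! i)" using g(3) len by (metis nth_map)
    then show "gs ! i = gs' ! i" using Comp.IH(2)[of "gs ! i"] i by simp
  qed
  then show ?case using g Comp.IH(1) by simp
next
  case (PrimRec f1 f2)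
  then show ?case by (cases g) auto
next
  case (Minim f)
  then show ?case by (cases g) auto
qed (case_tac g; simp)+

lemma recf_tree_eq_iff [simp]: "recf_tree f = recf_tree g \<longleftrightarrow> f = g"
  using recf_tree_inject by blast

lemma map_tree_inject [simp]: "map nat_tree xs = map nat_tree ys \<longleftrightarrow> xs = ys"
  "map recf_tree fs = map recf_tree gs \<longleftrightarrow> fs = gs"
  by (rule inj_map_eq_map; simp add: inj_def)+

lemma list_tree_map_eq:
  "list_tree (map h xs) = Leaf \<longleftrightarrow> xs = []"
  "list_tree (map h xs) = Node a b \<longleftrightarrow> (\<exists>x xs'. xs = x # xs' \<and> a = h x \<and> b = list_tree (map h xs'))"
  by (cases xs; auto)+

lemma nat_tree_eq:
  "nat_tree n = Leaf \<longleftrightarrow> n = 0"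
  "nat_tree n = Node a b \<longleftrightarrow> (\<exists>m. n = Suc m \<and> a = Leaf \<and> b = nat_tree m)"
  by (cases n; auto)+

section \<open>Horn clauses for computations\<close>

definition fact3 :: "nat \<Rightarrow> tree \<Rightarrow> tree \<Rightarrow> tree \<Rightarrow> tree" where
  "fact3 k a b c = Node (tag k) (Node a (Node b c))"

lemma fact3_inject [simp]:
  "fact3 k a b c = fact3 k' a' b' c' \<longleftrightarrow> k = k' \<and> a = a' \<and> b = b' \<and> c = c'"
  by (auto simp: fact3_def)

definition fact_tm :: "nat \<Rightarrow> tm \<Rightarrow> tm \<Rightarrow> tm \<Rightarrow> tm" where
  "fact_tm k a b c = Nd (tm_of (tag k)) (Nd a (Nd b c))"

lemma eval_tm_fact_tm [simp]: "eval_tm \<sigma> (fact_tm k a b c) = fact3 k (eval_tm \<sigma> a) (eval_tm \<sigma> b) (eval_tm \<sigma> c)"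
  by (simp add: fact_tm_def fact3_def)

lemma tm_vars_fact_tm [simp]: "tm_vars (fact_tm k a b c) = tm_vars a \<union> tm_vars b \<union> tm_vars c"
  by (auto simp: fact_tm_def)

abbreviation tag_tm :: "nat \<Rightarrow> tm \<Rightarrow> tm" where
  "tag_tm k a \<equiv> Nd (tm_of (tag k)) a"

text \<open>The facts with tags 0, 4, 2 and 3 say, respectively, that a program has a value on an argument list,
  that a list has a given entry, that a list of programs has a list of values, and that a program has
  positive values for all first arguments below a bound.\<close>

definition computes_clauses :: "(tm list \<times> tm) list" where
  "computes_clauses =
    [([], fact_tm 0 (tag_tm 0 Lf) (Var 0) Lf),
     ([], fact_tm 0 (tag_tm 6 Lf) (Nd (Var 0) Lf) (Nd Lf (Var 0))),
     ([fact_tm 4 (Var 0) (Var 1) (Var 2)], fact_tm 0 (tag_tm 2 (Var 0)) (Var 1) (Var 2)),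
     ([], fact_tm 4 Lf (Nd (Var 0) (Var 1)) (Var 0)),
     ([fact_tm 4 (Var 0) (Var 1) (Var 2)], fact_tm 4 (Nd Lf (Var 0)) (Nd (Var 3) (Var 1)) (Var 2)),
     ([fact_tm 2 (Var 1) (Var 2) (Var 3), fact_tm 0 (Var 0) (Var 3) (Var 4)],
        fact_tm 0 (tag_tm 3 (Nd (Var 0) (Var 1))) (Var 2) (Var 4)),
     ([], fact_tm 2 Lf (Var 0) Lf),
     ([fact_tm 0 (Var 0) (Var 2) (Var 3), fact_tm 2 (Var 1) (Var 2) (Var 4)],
        fact_tm 2 (Nd (Var 0) (Var 1)) (Var 2) (Nd (Var 3) (Var 4))),
     ([fact_tm 0 (Var 0) (Var 2) (Var 3)], fact_tm 0 (tag_tm 4 (Nd (Var 0) (Var 1))) (Nd Lf (Var 2)) (Var 3)),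
     ([fact_tm 0 (tag_tm 4 (Nd (Var 0) (Var 1))) (Nd (Var 2) (Var 3)) (Var 4), fact_tm 0 (Var 1) (Nd (Var 2) (Nd (Var 4) (Var 3))) (Var 5)],
        fact_tm 0 (tag_tm 4 (Nd (Var 0) (Var 1))) (Nd (Nd Lf (Var 2)) (Var 3)) (Var 5)),
     ([fact_tm 3 (Var 0) (Var 1) (Var 2), fact_tm 0 (Var 0) (Nd (Var 1) (Var 2)) Lf],
        fact_tm 0 (tag_tm 5 (Var 0)) (Var 2) (Var 1)),
     ([], fact_tm 3 (Var 0) Lf (Var 1)),
     ([fact_tm 3 (Var 0) (Var 1) (Var 2), fact_tm 0 (Var 0) (Nd (Var 1) (Var 2)) (Nd Lf (Var 3))],
        fact_tm 3 (Var 0) (Nd Lf (Var 1)) (Var 2))]"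

text \<open>The closed sets are the Herbrand models of the clauses.\<close>

definition closed_computes_clauses :: "tree set \<Rightarrow> bool" where
  "closed_computes_clauses A \<longleftrightarrow> (\<forall>(ps, h)\<in>set computes_clauses. \<forall>\<sigma>. (\<forall>p\<in>set ps. eval_tm \<sigma> p \<in> A) \<longrightarrow> eval_tm \<sigma> h \<in> A)"

lemma closed_computes_clauses_iff:
  "closed_computes_clauses A \<longleftrightarrow>
     (\<forall>x. fact3 0 (Node (tag 0) Leaf) x Leaf \<in> A) \<and>
     (\<forall>x. fact3 0 (Node (tag 6) Leaf) (Node x Leaf) (Node Leaf x) \<in> A) \<and>
     (\<forall>i x y. fact3 4 i x y \<in> A \<longrightarrow> fact3 0 (Node (tag 2) i) x y \<in> A) \<and>
     (\<forall>x xs. fact3 4 Leaf (Node x xs) x \<in> A) \<and>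
     (\<forall>i xs y x. fact3 4 i xs y \<in> A \<longrightarrow> fact3 4 (Node Leaf i) (Node x xs) y \<in> A) \<and>
     (\<forall>f gs xs ys z. fact3 2 gs xs ys \<in> A \<and> fact3 0 f ys z \<in> A \<longrightarrow> fact3 0 (Node (tag 3) (Node f gs)) xs z \<in> A) \<and>
     (\<forall>xs. fact3 2 Leaf xs Leaf \<in> A) \<and>
     (\<forall>g gs xs y ys. fact3 0 g xs y \<in> A \<and> fact3 2 gs xs ys \<in> A \<longrightarrow> fact3 2 (Node g gs) xs (Node y ys) \<in> A) \<and>
     (\<forall>f g xs y. fact3 0 f xs y \<in> A \<longrightarrow> fact3 0 (Node (tag 4) (Node f g)) (Node Leaf xs) y \<in> A) \<and>
     (\<forall>f g k xs y z. fact3 0 (Node (tag 4) (Node f g)) (Node k xs) y \<in> A \<and> fact3 0 g (Node k (Node y xs)) z \<in> A \<longrightarrow>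
        fact3 0 (Node (tag 4) (Node f g)) (Node (Node Leaf k) xs) z \<in> A) \<and>
     (\<forall>f k xs. fact3 3 f k xs \<in> A \<and> fact3 0 f (Node k xs) Leaf \<in> A \<longrightarrow> fact3 0 (Node (tag 5) f) xs k \<in> A) \<and>
     (\<forall>f xs. fact3 3 f Leaf xs \<in> A) \<and>
     (\<forall>f k xs y. fact3 3 f k xs \<in> A \<and> fact3 0 f (Node k xs) (Node Leaf y) \<in> A \<longrightarrow> fact3 3 f (Node Leaf k) xs \<in> A)" (is "_ \<longleftrightarrow> ?R")
proof (rule iffI)
  assume "closed_computes_clauses A"
  \<comment> \<open>The clauses use the variables 0 to 5 only, so assignments given by lists of six
    trees suffice.\<close>
  then have "\<forall>(ps, h)\<in>set computes_clauses. (\<forall>p\<in>set ps. eval_tm (\<lambda>i. [a, b, c, d, e, f] ! i) p \<in> A) \<longrightarrow>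
      eval_tm (\<lambda>i. [a, b, c, d, e, f] ! i) h \<in> A" for a b c d e f
    unfolding closed_computes_clauses_def by blast
  note H = this[unfolded computes_clauses_def, simplified]
  show ?R
  proof (intro conjI allI impI, goal_cases)
    case (1 x)
    then show ?case using H[of x x x x x x] by simp
  next
    case (2 x)
    then show ?case using H[of x x x x x x] by simp
  next
    case (3 i x y)
    then show ?case using H[of i x y y y y] by simp
  next
    case (4 x xs)
    then show ?case using H[of x xs xs xs xs xs] by simp
  next
    case (5 i xs y x)
    then show ?case using H[of i xs y x x x] by simp
  next
    case (6 f gs xs ys z)
    then show ?case using H[of f gs xs ys z z] by simp
  next
    case (7 xs)
    then show ?case using H[of xs xs xs xs xs xs] by simp
  next
    case (8 g gs xs y ys)
    then show ?case using H[of g gs xs y ys ys] by simp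
  next
    case (9 f g xs y)
    then show ?case using H[of f g xs y y y] by simp
  next
    case (10 f g k xs y z)
    then show ?case using H[of f g k xs y z] by simp
  next
    case (11 f k xs)
    then show ?case using H[of f k xs xs xs xs] by simp
  next
    case (12 f xs)
    then show ?case using H[of f xs xs xs xs xs] by simp
  next
    case (13 f k xs y)
    then show ?case using H[of f k xs y y y] by simp
  qed
next
  assume ?R
  then show "closed_computes_clauses A"
    unfolding closed_computes_clauses_def computes_clauses_def by simp blast
qed

text \<open>Every computation can be imitated by clauses. The auxiliary facts on list entries, lists
  of programs and bounds are derived by inner inductions.\<close>

lemma closed_computes_clausesD:
  assumes "closed_computes_clauses A"
  shows "computes f xs y \<Longrightarrow> fact3 0 (recf_tree f) (nats_tree xs) (nat_tree y) \<in> A"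
proof (induction rule: computes.induct)
  case (3 i xs)
  have "fact3 4 (nat_tree i) (nats_tree xs) (nat_tree (xs ! i)) \<in> A"
    using 3
  proof (induction i arbitrary: xs)
    case 0
    then show ?case using assms by (cases xs) (auto simp: closed_computes_clauses_iff)
  next
    case (Suc i)
    then show ?case using assms by (cases xs) (auto simp: closed_computes_clauses_iff)
  qed
  then show ?case using assms by (simp add: closed_computes_clauses_iff)
next
  case (4 xs gs ys f z)
  have "fact3 2 (list_tree (map recf_tree gs)) (nats_tree xs) (nats_tree ys) \<in> A"
    using 4(1)
  proof (induction gs ys)
    case Nil
    then show ?case using assms by (simp add: closed_computes_clauses_iff)
  next
    case (Cons g gs y ys)
    then show ?case using assms by (simp add: closed_computes_clauses_iff)
  qed
  then show ?case using 4 assms by (auto simp: closed_computes_clauses_iff)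
next
  case (6 f g k xs y z)
  then show ?case using assms by (auto simp: closed_computes_clauses_iff)
next
  case (7 f k xs)
  have "fact3 3 (recf_tree f) (nat_tree j) (nats_tree xs) \<in> A" if "j \<le> k" for j
    using that
  proof (induction j)
    case 0
    then show ?case using assms by (simp add: closed_computes_clauses_iff)
  next
    case (Suc j)
    then obtain y where "fact3 0 (recf_tree f) (nats_tree (j # xs)) (nat_tree (Suc y)) \<in> A"
      using 7(3) Suc.prems by (meson Suc_le_lessD)
    then have "fact3 0 (recf_tree f) (Node (nat_tree j) (nats_tree xs)) (Node Leaf (nat_tree y)) \<in> A" by simp
    moreover have "fact3 3 (recf_tree f) (nat_tree j) (nats_tree xs) \<in> A" using Suc by simp
    ultimately have "fact3 3 (recf_tree f) (Node Leaf (nat_tree j)) (nats_tree xs) \<in> A"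
      using assms unfolding closed_computes_clauses_iff by blast
    then show ?case by simp
  qed
  from this[of k] show ?case using 7 assms by (auto simp: closed_computes_clauses_iff)
qed (use assms in \<open>auto simp: closed_computes_clauses_iff\<close>)

definition true_facts :: "tree set" where
  "true_facts = {t.
     (\<forall>f xs y. t = fact3 0 (recf_tree f) (nats_tree xs) y \<longrightarrow> (\<exists>n. y = nat_tree n \<and> computes f xs n)) \<and>
     (\<forall>i xs y. t = fact3 4 (nat_tree i) (nats_tree xs) y \<longrightarrow> i < length xs \<and> y = nat_tree (xs ! i)) \<and>
     (\<forall>gs xs y. t = fact3 2 (list_tree (map recf_tree gs)) (nats_tree xs) y \<longrightarrow>
        (\<exists>ys. y = nats_tree ys \<and> list_all2 (\<lambda>g. computes g xs) gs ys)) \<and>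
     (\<forall>f k xs. t = fact3 3 (recf_tree f) k (nats_tree xs) \<longrightarrow>
        (\<exists>n. k = nat_tree n \<and> (\<forall>j<n. \<exists>y. computes f (j # xs) (Suc y))))}"

lemma true_facts_iff:
  "fact3 0 a b c \<in> true_facts \<longleftrightarrow>
     (\<forall>f xs. a = recf_tree f \<longrightarrow> b = nats_tree xs \<longrightarrow> (\<exists>n. c = nat_tree n \<and> computes f xs n))"
  "fact3 4 a b c \<in> true_facts \<longleftrightarrow>
     (\<forall>i xs. a = nat_tree i \<longrightarrow> b = nats_tree xs \<longrightarrow> i < length xs \<and> c = nat_tree (xs ! i))"
  "fact3 2 a b c \<in> true_facts \<longleftrightarrow>
     (\<forall>gs xs. a = list_tree (map recf_tree gs) \<longrightarrow> b = nats_tree xs \<longrightarrow> (\<exists>ys. c = nats_tree ys \<and> list_all2 (\<lambda>g. computes g xs) gs ys))"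
  "fact3 3 a b c \<in> true_facts \<longleftrightarrow>
     (\<forall>f xs. a = recf_tree f \<longrightarrow> c = nats_tree xs \<longrightarrow> (\<exists>n. b = nat_tree n \<and> (\<forall>j<n. \<exists>y. computes f (j # xs) (Suc y))))"
  by (auto simp: true_facts_def)

lemma node_eq_recf_tree:
  "Node (tag 0) a = recf_tree f \<longleftrightarrow> f = Zero \<and> a = Leaf"
  "Node (tag 6) a = recf_tree f \<longleftrightarrow> f = Succ \<and> a = Leaf"
  "Node (tag 2) a = recf_tree f \<longleftrightarrow> (\<exists>i. f = Proj i \<and> a = nat_tree i)"
  "Node (tag 3) (Node a b) = recf_tree f \<longleftrightarrow> (\<exists>f' gs. f = Comp f' gs \<and> a = recf_tree f' \<and> b = list_tree (map recf_tree gs))"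
  "Node (tag 4) (Node a b) = recf_tree f \<longleftrightarrow> (\<exists>f' g. f = PrimRec f' g \<and> a = recf_tree f' \<and> b = recf_tree g)"
  "Node (tag 5) a = recf_tree f \<longleftrightarrow> (\<exists>f'. f = Minim f' \<and> a = recf_tree f')"
  by (simp_all add: recf_tree_eq_tag eq_commute[of "Node _ _"])

lemma tree_eq_code:
  "Leaf = list_tree (map h xs) \<longleftrightarrow> xs = []"
  "Node a b = list_tree (map h xs) \<longleftrightarrow> (\<exists>x xs'. xs = x # xs' \<and> a = h x \<and> b = list_tree (map h xs'))"
  "Leaf = nat_tree n \<longleftrightarrow> n = 0"
  "Node a b = nat_tree n \<longleftrightarrow> (\<exists>m. n = Suc m \<and> a = Leaf \<and> b = nat_tree m)"
  by (simp_all add: list_tree_map_eq nat_tree_eq eq_commute[of Leaf] eq_commute[of "Node a b"])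

text \<open>If the inputs of the head are codes, so are the inputs of the premises, taken from left
  to right, because a true fact with coded inputs has a coded output. After that each clause is a
  rule of \<open>computes\<close> or a property of lists or bounds.\<close>

lemma closed_true_facts: "closed_computes_clauses true_facts"
  unfolding closed_computes_clauses_iff
  apply (intro conjI allI impI; (elim conjE)?)
  subgoal by (auto simp: true_facts_iff node_eq_recf_tree tree_eq_code intro: computes.intros)
  subgoal by (auto simp: true_facts_iff node_eq_recf_tree tree_eq_code intro: computes.intros)
  subgoal by (auto simp: true_facts_iff node_eq_recf_tree tree_eq_code intro: computes.intros)
  subgoal by (auto simp: true_facts_iff node_eq_recf_tree tree_eq_code)
  subgoal by (auto simp: true_facts_iff node_eq_recf_tree tree_eq_code)
  subgoal by (fastforce simp: true_facts_iff node_eq_recf_tree tree_eq_code intro: computes.intros)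
  subgoal by (auto simp: true_facts_iff node_eq_recf_tree tree_eq_code)
  subgoal by (fastforce simp: true_facts_iff node_eq_recf_tree tree_eq_code)
  subgoal by (force simp: true_facts_iff node_eq_recf_tree tree_eq_code intro: computes.intros(5))
  subgoal by (fastforce simp: true_facts_iff node_eq_recf_tree tree_eq_code intro: computes.intros(6))
  subgoal by (fastforce simp: true_facts_iff node_eq_recf_tree tree_eq_code intro: computes.intros(7))
  subgoal by (auto simp: true_facts_iff node_eq_recf_tree tree_eq_code)
  subgoal by (fastforce simp: true_facts_iff node_eq_recf_tree tree_eq_code less_Suc_eq)
  done

section \<open>Computable operations on codes of formulas\<close>

definition computable1 :: "(nat \<Rightarrow> nat) \<Rightarrow> bool" where
  "computable1 h \<longleftrightarrow> (\<exists>r. \<forall>x. computes r [x] (h x))"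

lemma computable1_const: "computable1 (\<lambda>_. k)"
proof (induction k)
  case 0
  show ?case unfolding computable1_def by (blast intro: computes.intros)
next
  case (Suc k)
  then obtain r where "\<And>x. computes r [x] k" by (auto simp: computable1_def)
  then have "computes (Comp Succ [r]) [x] (Suc k)" for x
    by (auto intro!: computes.intros(4)[of _ _ "[k]"] computes.intros(2))
  then show ?case unfolding computable1_def by blast
qed

lemma computable1_id: "computable1 (\<lambda>x. x)"
  unfolding computable1_def using computes.intros(3)[of 0 "[_]"] by auto

text \<open>Programs for addition and for \<open>triangle\<close> are composed according to
  \<open>prod_encode (x, y) = triangle (x + y) + x\<close>.\<close>

lemma computes_prod_encode:
  "\<exists>r. \<forall>x y. computes r [x, y] (prod_encode (x, y))"
proof -
  define add where "add = PrimRec (Proj 0) (Comp Succ [Proj 1])"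
  have add: "computes add [x, y] (x + y)" for x y
  proof (induction x)
    case 0
    show ?case using computes.intros(5)[OF computes.intros(3)[of 0 "[y]"]] by (simp add: add_def)
  next
    case (Suc x)
    have "computes (Comp Succ [Proj 1]) [x, x + y, y] (Suc (x + y))"
      using computes.intros(3)[of 1 "[x, x + y, y]"]
      by (auto intro!: computes.intros(4)[of _ _ "[x + y]"] computes.intros(2))
    then show ?case using Suc computes.intros(6) by (simp add: add_def)
  qed
  define tri where "tri = PrimRec Zero (Comp add [Proj 1, Comp Succ [Proj 0]])"
  have tri: "computes tri [x] (triangle x)" for x
  proof (induction x)
    case 0
    show ?case using computes.intros(5)[OF computes.intros(1)] by (simp add: tri_def)
  next
    case (Suc x)
    have "computes (Comp Succ [Proj 0]) [x, triangle x] (Suc x)"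
      using computes.intros(3)[of 0 "[x, triangle x]"]
      by (auto intro!: computes.intros(4)[of _ _ "[x]"] computes.intros(2))
    then have "computes (Comp add [Proj 1, Comp Succ [Proj 0]]) [x, triangle x] (triangle x + Suc x)"
      using computes.intros(3)[of 1 "[x, triangle x]"]
      by (intro computes.intros(4)[of _ _ "[triangle x, Suc x]"] add) auto
    then show ?case using Suc computes.intros(6) by (simp add: tri_def)
  qed
  have pair: "computes (Comp add [Comp tri [add], Proj 0]) [x, y] (prod_encode (x, y))" for x y
  proof -
    have "computes (Comp tri [add]) [x, y] (triangle (x + y))"
      by (rule computes.intros(4)[of _ _ "[x + y]"]) (auto intro: add tri)
    then have "computes (Comp add [Comp tri [add], Proj 0]) [x, y] (triangle (x + y) + x)"
      using computes.intros(3)[of 0 "[x, y]"]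
      by (intro computes.intros(4)[of _ _ "[triangle (x + y), x]"] add) auto
    then show ?thesis by (simp add: prod_encode_def)
  qed
  then show ?thesis by blast
qed

lemma computable1_prod_encode:
  assumes "computable1 g" "computable1 h"
  shows "computable1 (\<lambda>x. prod_encode (g x, h x))"
proof -
  obtain p where p: "\<And>x y. computes p [x, y] (prod_encode (x, y))"
    using computes_prod_encode by blast
  obtain r s where rs: "\<And>x. computes r [x] (g x)" "\<And>x. computes s [x] (h x)"
    using assms by (auto simp: computable1_def)
  have "computes (Comp p [r, s]) [x] (prod_encode (g x, h x))" for x
    by (rule computes.intros(4)[of _ _ "[g x, h x]"]) (auto intro: p rs)
  then show ?thesis unfolding computable1_def by blast
qed

text \<open>The argument is both the number of iterations and their starting point; this provides
  the self-reference in the diagonal argument.\<close>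

lemma computable1_iterate:
  assumes "computable1 g" "computable1 h"
  shows "computable1 (\<lambda>x. g ((h ^^ x) x))"
proof -
  obtain r s where rs: "\<And>x. computes r [x] (g x)" "\<And>x. computes s [x] (h x)"
    using assms by (auto simp: computable1_def)
  define it where "it = PrimRec (Proj 0) (Comp s [Proj 1])"
  have it: "computes it [k, x] ((h ^^ k) x)" for k x
  proof (induction k)
    case 0
    show ?case using computes.intros(5)[OF computes.intros(3)[of 0 "[x]"]] by (simp add: it_def)
  next
    case (Suc k)
    have "computes (Comp s [Proj 1]) [k, (h ^^ k) x, x] (h ((h ^^ k) x))"
      using computes.intros(3)[of 1 "[k, (h ^^ k) x, x]"]
      by (intro computes.intros(4)[of _ _ "[(h ^^ k) x]"] rs) auto
    then show ?case using Suc computes.intros(6) by (simp add: it_def)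
  qed
  have "computes (Comp it [Proj 0, Proj 0]) [x] ((h ^^ x) x)" for x
    using computes.intros(3)[of 0 "[x]"]
    by (intro computes.intros(4)[of _ _ "[x, x]"] it) auto
  then have "computes (Comp r [Comp it [Proj 0, Proj 0]]) [x] (g ((h ^^ x) x))" for x
    by (intro computes.intros(4)[of _ _ "[(h ^^ x) x]"] rs) auto
  then show ?thesis unfolding computable1_def by blast
qed

definition code_computable :: "(mform \<Rightarrow> mform) \<Rightarrow> bool" where
  "code_computable \<Phi> \<longleftrightarrow> (\<exists>h. computable1 h \<and> (\<forall>p. goedel (\<Phi> p) = h (goedel p)))"

lemma code_computable_const: "code_computable (\<lambda>_. p)"
  unfolding code_computable_def using computable1_const by auto

lemma code_computable_id: "code_computable (\<lambda>p. p)"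
  unfolding code_computable_def using computable1_id by auto

lemma code_computable_Neg:
  assumes "code_computable \<Phi>"
  shows "code_computable (\<lambda>p. Neg (\<Phi> p))"
proof -
  obtain h where "computable1 h" "\<And>p. goedel (\<Phi> p) = h (goedel p)"
    using assms by (auto simp: code_computable_def)
  then show ?thesis
    unfolding code_computable_def
    by (intro exI[of _ "\<lambda>x. prod_encode (4, h x)"])
      (auto intro!: computable1_prod_encode computable1_const)
qed

lemma code_computable_ExS:
  assumes "code_computable \<Phi>"
  shows "code_computable (\<lambda>p. ExS X (\<Phi> p))"
proof -
  obtain h where "computable1 h" "\<And>p. goedel (\<Phi> p) = h (goedel p)"
    using assms by (auto simp: code_computable_def)
  then show ?thesis
    unfolding code_computable_def
    by (intro exI[of _ "\<lambda>x. prod_encode (7, prod_encode (X, h x))"])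
      (auto intro!: computable1_prod_encode computable1_const)
qed

lemma code_computable_Conj:
  assumes "code_computable \<Phi>" "code_computable \<Psi>"
  shows "code_computable (\<lambda>p. Conj (\<Phi> p) (\<Psi> p))"
proof -
  obtain g h where "computable1 g" "\<And>p. goedel (\<Phi> p) = g (goedel p)"
    "computable1 h" "\<And>p. goedel (\<Psi> p) = h (goedel p)"
    using assms by (auto simp: code_computable_def)
  then show ?thesis
    unfolding code_computable_def
    by (intro exI[of _ "\<lambda>x. prod_encode (5, prod_encode (g x, h x))"])
      (auto intro!: computable1_prod_encode computable1_const)
qed

text \<open>The code of the hole formula is inserted into the code of the sentence without being
  decoded; applying \<open>Step\<close> as many times as this code says provides its numeral.\<close>

lemma undecidable_by_diagonalization:
  assumes "code_computable Ctx" "code_computable Step"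
    and G: "\<And>q x. Ctx ((Step ^^ x) (G q)) \<in> \<T> \<longleftrightarrow> computes q [x] 0"
  shows "\<not> decidable_theory \<T>"
proof
  assume "decidable_theory \<T>"
  then obtain f where f: "\<And>x. computes f [x] (if x \<in> goedel ` \<T> then 1 else 0)"
    by (auto simp: decidable_theory_def decidable_set_def)
  obtain g h where g: "computable1 g" "\<And>p. goedel (Ctx p) = g (goedel p)"
    and h: "computable1 h" "\<And>p. goedel (Step p) = h (goedel p)"
    using assms by (auto simp: code_computable_def)
  have iter: "goedel ((Step ^^ n) p) = (h ^^ n) (goedel p)" for n p
    by (induction n) (simp_all add: h)
  obtain d where d: "\<And>x. computes d [x] (g ((h ^^ x) x))"
    using computable1_iterate[OF g(1) h(1)] by (auto simp: computable1_def)
  \<comment> \<open>The program \<open>q\<close> builds from \<open>x\<close> the code of the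
    sentence about \<open>x\<close> and asks the supposed decision procedure. Choosing
    \<open>x\<close> as the code of \<open>G q\<close> makes this sentence speak of \<open>q\<close>
    on \<open>x\<close> itself.\<close>
  define q where "q = Comp f [d]"
  define x where "x = goedel (G q)"
  let ?S = "Ctx ((Step ^^ x) (G q))"
  have "goedel ?S = g ((h ^^ x) x)"
    by (simp add: g iter x_def)
  then have "computes d [x] (goedel ?S)" using d by simp
  then have "computes (Comp f [d]) [x] (if goedel ?S \<in> goedel ` \<T> then 1 else 0)"
    by (intro computes.intros(4)[of _ _ "[goedel ?S]"] f) simp
  \<comment> \<open>So \<open>q\<close> yields 0 on \<open>x\<close> exactly if the sentence is
    outside \<open>\<T>\<close>, whereas \<open>G\<close> says exactly if it is inside.\<close>
  then have q: "computes q [x] (if ?S \<in> \<T> then 1 else 0)"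
    by (simp add: inj_image_mem_iff[OF inj_goedel] flip: q_def)
  show False
  proof (cases "?S \<in> \<T>")
    case True
    then show False using q G[of x q] computes_deterministic[of q "[x]" 1 0] by simp
  next
    case False
    then show False using q G[of x q] by simp
  qed
qed

section \<open>The monadic sentences\<close>

definition Imp :: "mform \<Rightarrow> mform \<Rightarrow> mform" where
  "Imp p q = Neg (Conj p (Neg q))"

definition AllI :: "nat \<Rightarrow> mform \<Rightarrow> mform" where
  "AllI x p = Neg (ExI x (Neg p))"

definition AllS :: "nat \<Rightarrow> mform \<Rightarrow> mform" where
  "AllS X p = Neg (ExS X (Neg p))"

text \<open>The fold ends in a true formula without predicates and free variables.\<close>

definition Conjs :: "mform list \<Rightarrow> mform" where
  "Conjs ps = foldr Conj ps (AllI 0 (Equal 0 0))"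

lemma sat_derived [simp]:
  "sat F M e E (Imp p q) \<longleftrightarrow> (sat F M e E p \<longrightarrow> sat F M e E q)"
  "sat F M e E (AllI x p) \<longleftrightarrow> (\<forall>a. sat F M (e(x := a)) E p)"
  "sat F M e E (AllS X p) \<longleftrightarrow> (\<forall>A\<in>F. sat F M e (E(X := A)) p)"
  by (simp_all add: Imp_def AllI_def AllS_def)

lemma sat_Conjs [simp]: "sat F M e E (Conjs ps) \<longleftrightarrow> (\<forall>p\<in>set ps. sat F M e E p)"
  by (induction ps) (simp_all add: Conjs_def)

lemma syntax_derived [simp]:
  "preds_of (Imp p q) = preds_of p \<union> preds_of q" "preds_of (AllI x p) = preds_of p"
    "preds_of (AllS X p) = preds_of p"
  "free_ind (Imp p q) = free_ind p \<union> free_ind q" "free_ind (AllI x p) = free_ind p - {x}"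
    "free_ind (AllS X p) = free_ind p"
  "free_set (Imp p q) = free_set p \<union> free_set q" "free_set (AllI x p) = free_set p"
    "free_set (AllS X p) = free_set p - {X}"
  by (simp_all add: Imp_def AllI_def AllS_def)

lemma syntax_Conjs [simp]:
  "preds_of (Conjs ps) = (\<Union>p\<in>set ps. preds_of p)"
  "free_ind (Conjs ps) = (\<Union>p\<in>set ps. free_ind p)"
  "free_set (Conjs ps) = (\<Union>p\<in>set ps. free_set p)"
  by (induction ps) (simp_all add: Conjs_def)

section \<open>Formulas for the vocabulary of tokens\<close>

text \<open>Set variables: 0 to 3 are the flavours, 4 is the set of all points coding true facts, 5 is the token of
  the tree \<open>Leaf\<close>, and \<open>8 + i\<close> is the value of the term variable \<open>Var i\<close>. A last argument \<open>k\<close> is a bound above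
  which set variables are free to be quantified. The individual variables 4 and 5 are the endpoints of
  the current interval.\<close>

definition fSub :: "nat \<Rightarrow> nat \<Rightarrow> mform" where
  "fSub X Y = AllI 0 (Imp (Mem 0 X) (Mem 0 Y))"

definition fEq :: "nat \<Rightarrow> nat \<Rightarrow> mform" where
  "fEq X Y = Conj (fSub X Y) (fSub Y X)"

definition fLe :: "nat \<Rightarrow> nat \<Rightarrow> mform" where
  "fLe x y = Neg (Less y x)"

definition fBetween :: "nat \<Rightarrow> nat \<Rightarrow> nat \<Rightarrow> mform" where
  "fBetween a x b = Conj (Less a x) (Less x b)"

definition fLimdense :: "nat \<Rightarrow> nat \<Rightarrow> mform" where
  "fLimdense U S = AllI 0 (Imp (Mem 0 S) (AllI 1 (AllI 2 (Imp (fBetween 1 0 2)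
     (ExI 3 (Conj (Mem 3 U) (Conj (Mem 3 S) (Conj (Less 1 3) (Conj (Less 3 2) (Neg (Equal 3 0)))))))))))"

definition fAvoid :: "nat \<Rightarrow> mform" where
  "fAvoid S = AllI 0 (Imp (Pred 0 0) (ExI 1 (ExI 2 (Conj (fBetween 1 0 2)
     (Neg (ExI 3 (Conj (Mem 3 S) (fBetween 1 3 2))))))))"

definition fJoinI :: "nat \<Rightarrow> nat \<Rightarrow> nat \<Rightarrow> mform" where
  "fJoinI X Y k = ExS k (Conj (ExI 0 (Mem 0 k))
     (Conj (AllI 0 (Imp (Mem 0 k) (Conj (fBetween 4 0 5) (Imp (Neg (Mem 0 X)) (Mem 0 Y)))))
     (Conj (fLimdense X k) (Conj (fLimdense Y k) (fAvoid k)))))"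

definition fJoin :: "nat \<Rightarrow> nat \<Rightarrow> nat \<Rightarrow> mform" where
  "fJoin X Y k = AllI 4 (AllI 5 (Imp (Less 4 5) (fJoinI X Y k)))"

definition fDens :: "nat \<Rightarrow> mform" where
  "fDens X = AllI 0 (AllI 1 (Imp (Conj (fLe 4 0) (Conj (Less 0 1) (fLe 1 5)))
     (ExI 2 (Conj (Mem 2 X) (fBetween 0 2 1)))))"

definition fTok :: "nat \<Rightarrow> nat \<Rightarrow> nat \<Rightarrow> mform" where
  "fTok D X k = Conj (fSub X D)
     (Conj (AllI 0 (AllI 1 (Imp (Less 0 1) (ExI 2 (Conj (Mem 2 X) (fBetween 0 2 1))))))
     (AllI 4 (AllI 5 (Imp (Less 4 5) (AllS k (AllS (Suc k)
        (Imp (Conj (fSub k X) (Conj (fSub (Suc k) X) (Conj (fDens k) (fDens (Suc k)))))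
          (fJoinI k (Suc k) (k + 2)))))))))"

definition fPair :: "nat \<Rightarrow> nat \<Rightarrow> nat \<Rightarrow> nat \<Rightarrow> mform" where
  "fPair X Y W k = ExS k (ExS (k + 1) (ExS (k + 2)
     (Conj (fTok 1 k (k + 3)) (Conj (fTok 2 (k + 1) (k + 3)) (Conj (fTok 3 (k + 2) (k + 3))
     (Conj (fJoin X k (k + 3)) (Conj (fJoin Y (k + 1) (k + 3)) (Conj (fJoin k (k + 2) (k + 3))
     (Conj (fJoin (k + 1) (k + 2) (k + 3)) (fJoin W (k + 2) (k + 3)))))))))))"

definition fInC :: "nat \<Rightarrow> mform" where
  "fInC X = AllI 4 (AllI 5 (Imp (Less 4 5) (ExI 6 (ExI 7 (Conj (fLe 4 6) (Conj (Less 6 7) (Conj (fLe 7 5)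
     (AllI 0 (Imp (Conj (Mem 0 X) (fBetween 6 0 7)) (Mem 0 4))))))))))"

text \<open>Pairing is only a relation, so a compound term is flattened: each \<open>Nd\<close>
  introduces two quantified tokens for its children.\<close>

primrec fRep :: "tm \<Rightarrow> nat \<Rightarrow> nat \<Rightarrow> mform" where
  "fRep (Var i) w k = fEq w (8 + i)"
| "fRep Lf w k = fEq w 5"
| "fRep (Nd s t) w k = ExS k (ExS (k + 1) (Conj (fTok 0 k (k + 2)) (Conj (fTok 0 (k + 1) (k + 2))
     (Conj (fRep s k (k + 2)) (Conj (fRep t (k + 1) (k + 2)) (fPair k (k + 1) w (k + 2)))))))"

section \<open>The meaning of the formulas in the reals\<close>

abbreviation rmodel :: "real set list \<Rightarrow> real model" where
  "rmodel Qs \<equiv> \<lparr>lt = (<), preds = Qs\<rparr>"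

text \<open>The topological condition on \<open>Q\<close> in terms of order intervals only, the form
  in which \<open>fAvoid\<close> expresses it.\<close>

lemma closure_avoids_iff:
  "closure S \<inter> Q = {} \<longleftrightarrow>
     (\<forall>q::real. q \<in> Q \<longrightarrow> (\<exists>a b. (a < q \<and> q < b) \<and> \<not> (\<exists>x. x \<in> S \<and> a < x \<and> x < b)))"
  using closure_real_iff[of _ S] by (simp add: disjoint_iff) blast

lemma sat_fSub [simp]: "sat F (rmodel Qs) e E (fSub X Y) \<longleftrightarrow> E X \<subseteq> E Y"
  by (auto simp: fSub_def)

lemma sat_fEq [simp]: "sat F (rmodel Qs) e E (fEq X Y) \<longleftrightarrow> E X = E Y"
  by (auto simp: fEq_def)

lemma sat_fLe [simp]: "sat F (rmodel Qs) e E (fLe x y) \<longleftrightarrow> e x \<le> e y"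
  by (auto simp: fLe_def)

lemma sat_fBetween [simp]: "sat F (rmodel Qs) e E (fBetween a x b) \<longleftrightarrow> e a < e x \<and> e x < e b"
  by (auto simp: fBetween_def)

lemma sat_fLimdense [simp]: "sat F (rmodel Qs) e E (fLimdense U S) \<longleftrightarrow> limdense (E U) (E S)"
  by (simp add: fLimdense_def limdense_def Ball_def)

lemma sat_fAvoid [simp]: "sat F (rmodel Qs) e E (fAvoid S) \<longleftrightarrow> closure (E S) \<inter> Qs ! 0 = {}"
  by (simp add: fAvoid_def closure_avoids_iff)

lemma sat_fJoinI [simp]:
  "X < k \<Longrightarrow> Y < k \<Longrightarrow> sat F (rmodel Qs) e E (fJoinI X Y k) \<longleftrightarrow> joined_in F (Qs ! 0) (E X) (E Y) (e 4) (e 5)"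
  by (simp add: fJoinI_def joined_in_def Ball_def disj_imp ex_in_conv)

lemma sat_fJoin [simp]:
  "X < k \<Longrightarrow> Y < k \<Longrightarrow> sat F (rmodel Qs) e E (fJoin X Y k) \<longleftrightarrow> joined F (Qs ! 0) (E X) (E Y)"
  by (simp add: fJoin_def joined_def)

lemma sat_fDens [simp]: "sat F (rmodel Qs) e E (fDens X) \<longleftrightarrow> dense_in (E X) (e 4) (e 5)"
  by (simp add: fDens_def dense_in_def Bex_def)

lemma sat_fTok [simp]:
  "X < k \<Longrightarrow> D < k \<Longrightarrow> sat F (rmodel Qs) e E (fTok D X k) \<longleftrightarrow> token F (Qs ! 0) (E D) (E X)"
  by (simp add: fTok_def token_def Bex_def)

lemma sat_fPair [simp]:
  "X < k \<Longrightarrow> Y < k \<Longrightarrow> W < k \<Longrightarrow> 3 < k \<Longrightarrow>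
     sat F (rmodel Qs) e E (fPair X Y W k) \<longleftrightarrow> pair F (Qs ! 0) E (E X) (E Y) (E W)"
  by (simp add: fPair_def pair_def)

lemma sat_fInC [simp]: "sat F (rmodel Qs) e E (fInC X) \<longleftrightarrow> nearly_in (E 4) (E X)"
  by (simp add: fInC_def nearly_in_def Ball_def imp_conjL)

primrec represents :: "real set set \<Rightarrow> real set \<Rightarrow> (nat \<Rightarrow> real set) \<Rightarrow> real set \<Rightarrow> (nat \<Rightarrow> real set) \<Rightarrow> tm \<Rightarrow> real set \<Rightarrow> bool" where
  "represents F Q D z v (Var i) W \<longleftrightarrow> W = v i"
| "represents F Q D z v Lf W \<longleftrightarrow> W = z"
| "represents F Q D z v (Nd s t) W \<longleftrightarrow> (\<exists>X\<in>F. \<exists>Y\<in>F. token F Q (D 0) X \<and> token F Q (D 0) Y \<and>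
     represents F Q D z v s X \<and> represents F Q D z v t Y \<and> pair F Q D X Y W)"

lemma pair_cong: "(\<And>i. i < 4 \<Longrightarrow> D i = D' i) \<Longrightarrow> pair F Q D X Y W = pair F Q D' X Y W"
  by (simp add: pair_def)

lemma represents_cong:
  assumes "\<And>i. i < 4 \<Longrightarrow> D i = D' i" "\<And>i. i \<in> tm_vars t \<Longrightarrow> v i = v' i"
  shows "represents F Q D z v t W = represents F Q D' z v' t W"
  using assms
proof (induction t arbitrary: W)
  case (Nd s t)
  then show ?case using pair_cong[of D D' F Q] by simp
qed auto

text \<open>The bounds keep the quantified variables \<open>k\<close> and \<open>k + 1\<close> away
  from the parameters 0 to 5 and from the values of the term variables.\<close>

lemma sat_fRep [simp]:
  assumes "w < k" "\<forall>i\<in>tm_vars t. 8 + i < k" "5 < k"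
  shows "sat F (rmodel Qs) e E (fRep t w k) \<longleftrightarrow> represents F (Qs ! 0) E (E 5) (\<lambda>i. E (8 + i)) t (E w)"
  using assms
proof (induction t arbitrary: w k E)
  case (Nd s t)
  have IH: "sat F (rmodel Qs) e (E(k := A, Suc k := B)) (fRep s k (k + 2)) \<longleftrightarrow>
      represents F (Qs ! 0) E (E 5) (\<lambda>i. E (8 + i)) s A"
    "sat F (rmodel Qs) e (E(k := A, Suc k := B)) (fRep t (Suc k) (k + 2)) \<longleftrightarrow>
      represents F (Qs ! 0) E (E 5) (\<lambda>i. E (8 + i)) t B" for A B
  proof -
    have 1: "\<forall>i\<in>tm_vars s. 8 + i < k + 2" "\<forall>i\<in>tm_vars t. 8 + i < k + 2"
      using Nd.prems(2) by (metis UnI1 UnI2 trans_less_add1 tm_vars.simps(3))+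
    define E' where "E' = E(k := A, Suc k := B)"
    have D: "E' i = E i" if "i < 4" for i
      using that Nd.prems by (simp add: E'_def)
    have v: "E' (8 + i) = E (8 + i)" if "i \<in> tm_vars s \<union> tm_vars t" for i
    proof -
      have "8 + i < k" using that Nd.prems(2) by auto
      then show ?thesis by (simp add: E'_def)
    qed
    have E': "E' 5 = E 5" "E' k = A" "E' (Suc k) = B" using Nd.prems by (simp_all add: E'_def)
    have "sat F (rmodel Qs) e E' (fRep s k (k + 2)) \<longleftrightarrow> represents F (Qs ! 0) E' (E' 5) (\<lambda>i. E' (8 + i)) s (E' k)"
      by (rule Nd.IH(1)) (use Nd.prems 1 in auto)
    also have "\<dots> \<longleftrightarrow> represents F (Qs ! 0) E (E 5) (\<lambda>i. E (8 + i)) s A"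
      unfolding E' by (rule represents_cong[OF D v]) auto
    finally show "sat F (rmodel Qs) e (E(k := A, Suc k := B)) (fRep s k (k + 2)) \<longleftrightarrow>
        represents F (Qs ! 0) E (E 5) (\<lambda>i. E (8 + i)) s A" by (simp only: E'_def)
    have "sat F (rmodel Qs) e E' (fRep t (Suc k) (k + 2)) \<longleftrightarrow>
        represents F (Qs ! 0) E' (E' 5) (\<lambda>i. E' (8 + i)) t (E' (Suc k))"
      by (rule Nd.IH(2)) (use Nd.prems 1 in auto)
    also have "\<dots> \<longleftrightarrow> represents F (Qs ! 0) E (E 5) (\<lambda>i. E (8 + i)) t B"
      unfolding E' by (rule represents_cong[OF D v]) auto
    finally show "sat F (rmodel Qs) e (E(k := A, Suc k := B)) (fRep t (Suc k) (k + 2)) \<longleftrightarrow>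
        represents F (Qs ! 0) E (E 5) (\<lambda>i. E (8 + i)) t B" by (simp only: E'_def)
  qed
  have pair: "pair F (Qs ! 0) (E(k := A, Suc k := B)) A B (E w) = pair F (Qs ! 0) E A B (E w)" for A B
    using Nd.prems by (intro pair_cong) auto
  show ?case using Nd.prems IH pair by simp
qed simp_all

section \<open>Predicates and free variables of the formulas\<close>

lemma preds_of_f [simp]:
  "preds_of (fSub X Y) = {}" "preds_of (fEq X Y) = {}" "preds_of (fLe x y) = {}" "preds_of (fBetween x y z) = {}"
  "preds_of (fLimdense X Y) = {}" "preds_of (fAvoid X) = {0}" "preds_of (fJoinI X Y k) = {0}"
  "preds_of (fJoin X Y k) = {0}" "preds_of (fDens X) = {}" "preds_of (fTok X Y k) = {0}"
  "preds_of (fPair X Y W k) = {0}" "preds_of (fInC X) = {}"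
  by (simp_all add: fSub_def fEq_def fLe_def fBetween_def fLimdense_def fAvoid_def fJoinI_def fJoin_def
      fDens_def fTok_def fPair_def fInC_def)

lemma free_ind_f [simp]:
  "free_ind (fSub X Y) = {}" "free_ind (fEq X Y) = {}" "free_ind (fLe x y) = {x, y}"
    "free_ind (fBetween x y z) = {x, y, z}"
  "free_ind (fLimdense X Y) = {}" "free_ind (fAvoid X) = {}" "free_ind (fJoinI X Y k) = {4, 5}"
  "free_ind (fJoin X Y k) = {}" "free_ind (fDens X) = {4, 5}" "free_ind (fTok X Y k) = {}"
  "free_ind (fPair X Y W k) = {}" "free_ind (fInC X) = {}"
  by (auto simp: fSub_def fEq_def fLe_def fBetween_def fLimdense_def fAvoid_def fJoinI_def fJoin_def
      fDens_def fTok_def fPair_def fInC_def)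

lemma free_set_f [simp]:
  "free_set (fSub X Y) = {X, Y}" "free_set (fEq X Y) = {X, Y}" "free_set (fLe x y) = {}"
    "free_set (fBetween x y z) = {}"
  "free_set (fLimdense X Y) = {X, Y}" "free_set (fAvoid X) = {X}" "free_set (fJoinI X Y k) = {X, Y} - {k}"
  "free_set (fJoin X Y k) = {X, Y} - {k}" "free_set (fDens X) = {X}"
  "free_set (fInC X) = {4, X}"
  by (auto simp: fSub_def fEq_def fLe_def fBetween_def fLimdense_def fAvoid_def fJoinI_def fJoin_def
      fDens_def fInC_def)

lemma free_set_fTok: "free_set (fTok D X k) \<subseteq> {D, X}"
  by (auto simp: fTok_def)

lemma free_set_fPair: "free_set (fPair X Y W k) \<subseteq> {1, 2, 3, X, Y, W}"
  using free_set_fTok unfolding fPair_def by fastforce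

lemma preds_of_fRep: "preds_of (fRep t w k) \<subseteq> {0}"
  by (induction t arbitrary: w k) auto

lemma free_ind_fRep [simp]: "free_ind (fRep t w k) = {}"
  by (induction t arbitrary: w k) auto

lemma free_set_fRep: "free_set (fRep t w k) \<subseteq> {..5} \<union> {w} \<union> (+) 8 ` tm_vars t"
proof (induction t arbitrary: w k)
  case (Nd s t)
  show ?case
    using Nd[of k "k + 2"] Nd(2)[of "k + 1"
      "k + 2"] free_set_fTok[of 0 k "k + 2"] free_set_fTok[of 0 "k + 1" "k + 2"]
      free_set_fPair[of k "k + 1" w "k + 2"]
    by (auto simp: subset_iff)
qed auto

section \<open>The sentences of the reduction\<close>

primrec fAllToks :: "nat \<Rightarrow> mform \<Rightarrow> mform" where
  "fAllToks 0 p = p"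
| "fAllToks (Suc n) p = AllS (8 + n) (Imp (fTok 0 (8 + n) 16) (fAllToks n p))"

text \<open>The set variables 8 to 13 hold the six term variables, 14 the head and 15 a premise;
  from 16 on variables are free for use inside.\<close>

definition fClause :: "tm list \<times> tm \<Rightarrow> mform" where
  "fClause cl = fAllToks 6 (AllS 14 (Imp (Conj (fTok 0 14 16) (Conj (fRep (snd cl) 14 16)
     (Conjs (map (\<lambda>p. ExS 15 (Conj (fTok 0 15 16) (Conj (fRep p 15 16) (fInC 15)))) (fst cl))))) (fInC 14)))"

definition fModel :: mform where
  "fModel = Conj (fTok 0 5 6) (Conj
     (AllS 6 (AllS 7 (Imp (Conj (fTok 0 6 8) (fTok 0 7 8)) (ExS 8 (Conj (fTok 0 8 9) (fPair 6 7 8 9))))))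
     (Conjs (map fClause computes_clauses)))"

text \<open>The current numeral always sits in variable 8. Its successor is formed in 9 and copied
  back, so that one fixed operator can be iterated, whatever the number of steps.\<close>

definition fStep :: "mform \<Rightarrow> mform" where
  "fStep p = ExS 9 (Conj (fTok 0 9 10) (Conj (fPair 5 8 9 10) (ExS 8 (Conj (fEq 8 9) p))))"

definition fCtx :: "mform \<Rightarrow> mform" where
  "fCtx p = AllS 0 (AllS 1 (AllS 2 (AllS 3 (AllS 4 (AllS 5 (Imp fModel (ExS 8 (Conj (fEq 8 5) p))))))))"

definition halt_tm :: "recf \<Rightarrow> tm" where
  "halt_tm q = fact_tm 0 (tm_of (recf_tree q)) (Nd (Var 0) Lf) Lf"

definition fHalt :: "recf \<Rightarrow> mform" where
  "fHalt q = ExS 9 (Conj (fTok 0 9 10) (Conj (fRep (halt_tm q) 9 10) (fInC 9)))"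

definition clause_ok ::
    "real set set \<Rightarrow> real set \<Rightarrow> (nat \<Rightarrow> real set) \<Rightarrow> real set \<Rightarrow> real set \<Rightarrow> tm list \<times> tm \<Rightarrow> bool" where
  "clause_ok F Q D z C cl \<longleftrightarrow> (\<forall>v. (\<forall>i<6. v i \<in> F \<and> token F Q (D 0) (v i)) \<longrightarrow>
     (\<forall>W\<in>F. token F Q (D 0) W \<and> represents F Q D z v (snd cl) W \<and>
        (\<forall>p\<in>set (fst cl). \<exists>X\<in>F. token F Q (D 0) X \<and> represents F Q D z v p X \<and> nearly_in C X) \<longrightarrow> nearly_in C W))"

definition model_ok ::
    "real set set \<Rightarrow> real set \<Rightarrow> (nat \<Rightarrow> real set) \<Rightarrow> real set \<Rightarrow> real set \<Rightarrow> bool" where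
  "model_ok F Q D z C \<longleftrightarrow> token F Q (D 0) z \<and>
     (\<forall>X\<in>F. \<forall>Y\<in>F. token F Q (D 0) X \<and> token F Q (D 0) Y \<longrightarrow> (\<exists>W\<in>F. token F Q (D 0) W \<and> pair F Q D X Y W)) \<and>
     (\<forall>cl\<in>set computes_clauses. clause_ok F Q D z C cl)"

text \<open>The block of quantifiers is collapsed into a single valuation \<open>v\<close> of the
  term variables.\<close>

lemma sat_fAllToks:
  "n \<le> 8 \<Longrightarrow> sat F (rmodel Qs) e E (fAllToks n p) \<longleftrightarrow>
     (\<forall>v. (\<forall>i<n. v i \<in> F \<and> token F (Qs ! 0) (E 0) (v i)) \<longrightarrow>
        sat F (rmodel Qs) e (\<lambda>j. if 8 \<le> j \<and> j < 8 + n then v (j - 8) else E j) p)"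
proof (induction n arbitrary: E)
  case 0
  have "(\<lambda>j. if 8 \<le> j \<and> j < 8 + 0 then v (j - 8) else E j) = E" for v
    by (intro ext if_not_P) linarith
  then show ?case by simp
next
  case (Suc n)
  let ?o = "\<lambda>n v E j. if 8 \<le> j \<and> j < 8 + n then v (j - 8) else E j"
  have o: "?o n v (E(8 + n := A)) = ?o (Suc n) (v(n := A)) E" for v A
    by (auto simp: fun_eq_iff)
  have e0: "(E(8 + n := A)) 0 = E 0" for A by simp
  have IH: "sat F (rmodel Qs) e (E(8 + n := A)) (fAllToks n p) \<longleftrightarrow>
      (\<forall>v. (\<forall>i<n. v i \<in> F \<and> token F (Qs ! 0) (E 0) (v i)) \<longrightarrow>
        sat F (rmodel Qs) e (?o (Suc n) (v(n := A)) E) p)" for A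
    by (rule Suc.IH[of "E(8 + n := A)" for A, unfolded o e0]) (use Suc.prems in simp)
  show ?case
  proof
    assume l: "sat F (rmodel Qs) e E (fAllToks (Suc n) p)"
    show "\<forall>v. (\<forall>i<Suc n. v i \<in> F \<and> token F (Qs ! 0) (E 0) (v i)) \<longrightarrow>
        sat F (rmodel Qs) e (?o (Suc n) v E) p"
    proof (intro allI impI)
      fix v assume v: "\<forall>i<Suc n. v i \<in> F \<and> token F (Qs ! 0) (E 0) (v i)"
      then have "sat F (rmodel Qs) e (E(8 + n := v n)) (fAllToks n p)"
        using l Suc.prems by simp
      then have "sat F (rmodel Qs) e (?o (Suc n) (v(n := v n)) E) p"
        unfolding IH using v by (meson less_SucI)
      then show "sat F (rmodel Qs) e (?o (Suc n) v E) p" by (simp only: fun_upd_triv)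
    qed
  next
    assume r: "\<forall>v. (\<forall>i<Suc n. v i \<in> F \<and> token F (Qs ! 0) (E 0) (v i)) \<longrightarrow>
        sat F (rmodel Qs) e (?o (Suc n) v E) p"
    have "sat F (rmodel Qs) e (E(8 + n := A)) (fAllToks n p)"
      if "A \<in> F" "token F (Qs ! 0) (E 0) A" for A
      unfolding IH
    proof (intro allI impI)
      fix v assume v: "\<forall>i<n. v i \<in> F \<and> token F (Qs ! 0) (E 0) (v i)"
      show "sat F (rmodel Qs) e (?o (Suc n) (v(n := A)) E) p"
        by (rule r[rule_format]) (use v that in \<open>auto simp: less_Suc_eq\<close>)
    qed
    then show "sat F (rmodel Qs) e E (fAllToks (Suc n) p)"
      using Suc.prems by simp
  qed
qed

lemma computes_clauses_vars:
  assumes "cl \<in> set computes_clauses"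
  shows "tm_vars (snd cl) \<subseteq> {..<6}" "\<forall>p\<in>set (fst cl). tm_vars p \<subseteq> {..<6}"
  using assms by (auto simp: computes_clauses_def)

lemma sat_fClause [simp]:
  assumes "cl \<in> set computes_clauses"
  shows "sat F (rmodel Qs) e E (fClause cl) \<longleftrightarrow> clause_ok F (Qs ! 0) E (E 5) (E 4) cl"
proof -
  let ?o = "\<lambda>v j. if 8 \<le> j \<and> j < 8 + 6 then v (j - 8) else E j"
  have 1: "sat F (rmodel Qs) e ((?o v)(14 := W)) (fRep t 14 16) \<longleftrightarrow> represents F (Qs ! 0) E (E 5) v t W"
    if "tm_vars t \<subseteq> {..<6}" for v W t
  proof -
    have "\<forall>i\<in>tm_vars t. 8 + i < 16" using that by fastforce
    then have "sat F (rmodel Qs) e ((?o v)(14 := W)) (fRep t 14 16) \<longleftrightarrow>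
        represents F (Qs ! 0) ((?o v)(14 := W)) (E 5) (\<lambda>i. ((?o v)(14 := W)) (8 + i)) t W"
      by simp
    also have "\<dots> \<longleftrightarrow> represents F (Qs ! 0) E (E 5) v t W"
      by (rule represents_cong) (use that in auto)
    finally show ?thesis .
  qed
  have 2: "sat F (rmodel Qs) e ((?o v)(14 := W, 15 := X)) (fRep t 15 16) \<longleftrightarrow> represents F (Qs ! 0) E (E 5) v t X"
    if "tm_vars t \<subseteq> {..<6}" for v W X t
  proof -
    have "\<forall>i\<in>tm_vars t. 8 + i < 16" using that by fastforce
    then have "sat F (rmodel Qs) e ((?o v)(14 := W, 15 := X)) (fRep t 15 16) \<longleftrightarrow>
        represents F (Qs ! 0) ((?o v)(14 := W, 15 := X)) (E 5) (\<lambda>i. ((?o v)(14 := W, 15 := X)) (8 + i)) t X"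
      by simp
    also have "\<dots> \<longleftrightarrow> represents F (Qs ! 0) E (E 5) v t X"
      by (rule represents_cong) (use that in auto)
    finally show ?thesis .
  qed
  have "sat F (rmodel Qs) e (?o v) (AllS 14 (Imp (Conj (fTok 0 14 16) (Conj (fRep (snd cl) 14 16)
        (Conjs (map (\<lambda>p. ExS 15 (Conj (fTok 0 15 16) (Conj (fRep p 15 16) (fInC 15)))) (fst cl))))) (fInC 14))) \<longleftrightarrow>
      (\<forall>W\<in>F. token F (Qs ! 0) (E 0) W \<and> represents F (Qs ! 0) E (E 5) v (snd cl) W \<and>
        (\<forall>p\<in>set (fst cl). \<exists>X\<in>F. token F (Qs ! 0) (E 0) X \<and> represents F (Qs ! 0) E (E 5) v p X \<and> nearly_in (E 4) X) \<longrightarrow>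
        nearly_in (E 4) W)" for v
    using 1[OF computes_clauses_vars(1)[OF assms]] 2 computes_clauses_vars(2)[OF assms] by (simp del: sat_fRep)
  then show ?thesis
    unfolding fClause_def clause_ok_def by (subst sat_fAllToks) auto
qed

lemma sat_fModel [simp]:
  "sat F (rmodel Qs) e E fModel \<longleftrightarrow> model_ok F (Qs ! 0) E (E 5) (E 4)"
proof -
  have "pair F (Qs ! 0) (E(6 := X, 7 := Y, 8 := W)) X Y W = pair F (Qs ! 0) E X Y W" for X Y W
    by (rule pair_cong) simp
  then show ?thesis by (simp add: fModel_def model_ok_def)
qed

lemma sat_fStep:
  "sat F (rmodel Qs) e E (fStep p) \<longleftrightarrow> (\<exists>U\<in>F. token F (Qs ! 0) (E 0) U \<and> pair F (Qs ! 0) E (E 5) (E 8) U \<and>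
     sat F (rmodel Qs) e (E(9 := U, 8 := U)) p)"
proof -
  have "pair F (Qs ! 0) (E(9 := U)) X Y W = pair F (Qs ! 0) E X Y W" for X Y W U
    by (rule pair_cong) simp
  then show ?thesis by (auto simp: fStep_def)
qed

lemma tm_vars_halt_tm: "tm_vars (halt_tm q) = {0}"
  by (simp add: halt_tm_def)

lemma sat_fHalt:
  "sat F (rmodel Qs) e E (fHalt q) \<longleftrightarrow>
     (\<exists>W\<in>F. token F (Qs ! 0) (E 0) W \<and> represents F (Qs ! 0) E (E 5) (\<lambda>_. E 8) (halt_tm q) W \<and> nearly_in (E 4) W)"
proof -
  have "represents F (Qs ! 0) (E(9 := W)) (E 5) (\<lambda>i. (E(9 := W)) (8 + i)) (halt_tm q) W =
      represents F (Qs ! 0) E (E 5) (\<lambda>_. E 8) (halt_tm q) W" for W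
    by (rule represents_cong) (simp_all add: tm_vars_halt_tm)
  then show ?thesis by (simp add: fHalt_def tm_vars_halt_tm)
qed

lemma eval_tm_halt_tm: "eval_tm \<sigma> (halt_tm q) = fact3 0 (recf_tree q) (Node (\<sigma> 0) Leaf) Leaf"
  by (simp add: halt_tm_def)

lemma code_computable_fStep: "code_computable fStep"
  unfolding fStep_def
  by (intro code_computable_ExS code_computable_Conj code_computable_const code_computable_id)

lemma code_computable_fCtx: "code_computable fCtx"
  unfolding fCtx_def AllS_def Imp_def
  by (intro code_computable_Neg code_computable_ExS code_computable_Conj code_computable_const code_computable_id)

section \<open>From computations to validity, for arbitrary predicates\<close>

text \<open>For an arbitrary predicate, the token that pairs two given tokens need not be unique. Fixing one
  choice makes an equality relation on the tokens and its congruence axioms dispensable.\<close>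

lemma model_valuation:
  assumes ok: "model_ok F Q D z C" and "z \<in> F"
  obtains val where "\<And>t. val t \<in> F \<and> token F Q (D 0) (val t)" "val Leaf = z"
    "\<And>s t. pair F Q D (val s) (val t) (val (Node s t))"
proof -
  have "\<forall>X Y. \<exists>W. X \<in> F \<and> Y \<in> F \<and> token F Q (D 0) X \<and> token F Q (D 0) Y \<longrightarrow>
      W \<in> F \<and> token F Q (D 0) W \<and> pair F Q D X Y W"
    using ok unfolding model_ok_def by blast
  then obtain p where p: "\<And>X Y. X \<in> F \<and> Y \<in> F \<and> token F Q (D 0) X \<and> token F Q (D 0) Y \<longrightarrow>
      p X Y \<in> F \<and> token F Q (D 0) (p X Y) \<and> pair F Q D X Y (p X Y)"
    by metis
  define val where "val = rec_tree z (\<lambda>_ _. p)"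
  have val: "val Leaf = z" "val (Node s t) = p (val s) (val t)" for s t
    by (simp_all add: val_def)
  have token: "val t \<in> F \<and> token F Q (D 0) (val t)" for t
    using assms p by (induction t) (auto simp: val model_ok_def)
  show ?thesis using that[of val] token p val by simp
qed

lemma represents_valuation:
  assumes val: "\<And>t. val t \<in> F \<and> token F Q (D 0) (val t)" "val Leaf = z"
    "\<And>s t. pair F Q D (val s) (val t) (val (Node s t))"
    and v: "\<And>i. i \<in> tm_vars t \<Longrightarrow> v i = val (\<sigma> i)"
  shows "represents F Q D z v t (val (eval_tm \<sigma> t))"
  using v
proof (induction t)
  case (Nd s t)
  then have "represents F Q D z v s (val (eval_tm \<sigma> s))" "represents F Q D z v t (val (eval_tm \<sigma> t))" by simp_all
  then show ?case using val unfolding represents.simps eval_tm.simps by blast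
qed (auto simp: val)

text \<open>The chosen tokens can be substituted for the variables of a clause, and they represent
  its terms; so the trees whose tokens are nearly in \<open>C\<close> form a Herbrand model.\<close>

lemma closed_valuation:
  assumes ok: "model_ok F Q D z C" and val: "\<And>t. val t \<in> F \<and> token F Q (D 0) (val t)" "val Leaf = z"
    "\<And>s t. pair F Q D (val s) (val t) (val (Node s t))"
  shows "closed_computes_clauses {t. nearly_in C (val t)}"
proof -
  have "nearly_in C (val (eval_tm \<sigma> (snd cl)))"
    if cl: "cl \<in> set computes_clauses" and prem: "\<forall>p\<in>set (fst cl). nearly_in C (val (eval_tm \<sigma> p))" for cl \<sigma>
  proof -
    note represents = represents_valuation[of val F Q D z, OF val, where v = "\<lambda>i. val (\<sigma> i)" and \<sigma> = \<sigma>, OF refl]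
    have c: "clause_ok F Q D z C cl" using ok cl by (simp add: model_ok_def)
    have prem': "\<exists>X\<in>F. token F Q (D 0) X \<and> represents F Q D z (\<lambda>i. val (\<sigma> i)) p X \<and> nearly_in C X" if "p \<in> set (fst cl)" for p
      using val(1)[of "eval_tm \<sigma> p"] represents[of p] prem that by (intro bexI[of _ "val (eval_tm \<sigma> p)"]) simp_all
    show ?thesis
      by (rule c[unfolded clause_ok_def, rule_format, of "\<lambda>i. val (\<sigma> i)"]) (use val(1) represents prem' in simp_all)
  qed
  then show ?thesis unfolding closed_computes_clauses_def by (simp add: case_prod_beta)
qed

text \<open>Variable 8 holds the numeral of \<open>m\<close> and \<open>n\<close> steps remain; the
  induction keeps the sum \<open>m + n\<close> fixed.\<close>

lemma sat_iterated_step: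
  assumes ok: "model_ok F (Qs ! 0) D z C"
    and val: "\<And>t. val t \<in> F \<and> token F (Qs ! 0) (D 0) (val t)" "val Leaf = z"
    "\<And>s t. pair F (Qs ! 0) D (val s) (val t) (val (Node s t))"
    and E: "\<forall>i<4. E i = D i" "E 4 = C" "E 5 = z" "E 8 = val (nat_tree m)"
    and "computes q [m + n] 0"
  shows "sat F (rmodel Qs) e E ((fStep ^^ n) (fHalt q))"
  using E \<open>computes q [m + n] 0\<close>
proof (induction n arbitrary: m E)
  case 0
  let ?t = "eval_tm (\<lambda>_. nat_tree m) (halt_tm q)"
  have "represents F (Qs ! 0) D z (\<lambda>_. val (nat_tree m)) (halt_tm q) (val ?t)"
    by (rule represents_valuation[of val F "Qs ! 0" D z, OF val refl])
  moreover have "represents F (Qs ! 0) E (E 5) (\<lambda>_. E 8) (halt_tm q) (val ?t) =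
      represents F (Qs ! 0) D z (\<lambda>_. val (nat_tree m)) (halt_tm q) (val ?t)"
    unfolding 0 by (rule represents_cong) (use 0 in auto)
  moreover have "?t \<in> {t. nearly_in C (val t)}"
    using closed_computes_clausesD[OF closed_valuation[OF ok val] 0(5)] by (simp add: eval_tm_halt_tm)
  ultimately have "val ?t \<in> F \<and> token F (Qs ! 0) (E 0) (val ?t) \<and>
      represents F (Qs ! 0) E (E 5) (\<lambda>_. E 8) (halt_tm q) (val ?t) \<and> nearly_in (E 4) (val ?t)"
    using 0 val by simp
  then show ?case unfolding sat_fHalt funpow_0 by blast
next
  case (Suc n)
  have "pair F (Qs ! 0) E X Y W = pair F (Qs ! 0) D X Y W" for X Y W
    by (rule pair_cong) (use Suc.prems in auto)
  moreover have "pair F (Qs ! 0) D z (val (nat_tree m)) (val (nat_tree (Suc m)))"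
    using val(3)[of Leaf "nat_tree m"] val(2) by simp
  moreover have "sat F (rmodel Qs) e (E(9 := val (nat_tree (Suc m)), 8 := val (nat_tree (Suc m)))) ((fStep ^^ n) (fHalt q))"
    by (rule Suc.IH[of _ "Suc m"]) (use Suc.prems in auto)
  ultimately show ?case
    using Suc.prems val(1) by (auto simp: sat_fStep intro!: bexI[of _ "val (nat_tree (Suc m))"])
qed

lemma sat_fCtx_if_computes:
  assumes "computes q [x] 0"
  shows "sat F (rmodel Qs) e E (fCtx ((fStep ^^ x) (fHalt q)))"
proof -
  have "sat F (rmodel Qs) e (E'(8 := E' 5)) ((fStep ^^ x) (fHalt q))"
    if ok: "model_ok F (Qs ! 0) E' (E' 5) (E' 4)" and z: "E' 5 \<in> F" for E'
  proof -
    obtain val where val: "\<And>t. val t \<in> F \<and> token F (Qs ! 0) (E' 0) (val t)" "val Leaf = E' 5"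
      "\<And>s t. pair F (Qs ! 0) E' (val s) (val t) (val (Node s t))"
      using model_valuation[OF ok z] by blast
    show ?thesis
      by (rule sat_iterated_step[OF ok val, where m = 0]) (use assms val in auto)
  qed
  note H = this
  show ?thesis
    unfolding fCtx_def
  proof (simp, intro ballI impI, goal_cases)
    case (1 A0 A1 A2 A3 A4 A5)
    then show ?case
      using H[of "E(0 := A0, Suc 0 := A1, 2 := A2, 3 := A3, 4 := A4, 5 := A5)"] by simp
  qed
qed

section \<open>From validity to computations, for the predicate of a coding\<close>

context coded
begin

definition zero_token :: "real set" where
  "zero_token = {x\<in>\<rat>. c x = (0, Leaf)}"

definition fact_points :: "real set" where
  "fact_points = {x\<in>\<rat>. c x \<in> Pair 0 ` true_facts}"

text \<open>Representation computes terms locally: by induction on the term, every pairing is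
  evaluated by \<open>pair_monochrome\<close> after shrinking the interval.\<close>

lemma represents_monochrome:
  assumes "represents F Q D zero_token v t W" "token F Q (D 0) W"
    "\<forall>i\<in>tm_vars t. monochrome c (v i) a b (0, \<sigma> i)" "a < b"
  shows "\<exists>a' b'. a \<le> a' \<and> a' < b' \<and> b' \<le> b \<and> monochrome c W a' b' (0, eval_tm \<sigma> t)"
  using assms
proof (induction t arbitrary: W a b)
  case (Var i)
  then show ?case by auto
next
  case Lf
  then have "monochrome c W a b (0, Leaf)" by (simp add: zero_token_def monochrome_def)
  then show ?case using Lf by auto
next
  case (Nd s t)
  obtain X Y where XY: "token F Q (D 0) X" "token F Q (D 0) Y" "represents F Q D zero_token v s X"
    "represents F Q D zero_token v t Y" "pair F Q D X Y W"
    using Nd.prems(1) by auto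
  have v: "\<forall>i\<in>tm_vars s. monochrome c (v i) a b (0, \<sigma> i)" "\<forall>i\<in>tm_vars t. monochrome c (v i) a b (0, \<sigma> i)"
    using Nd.prems(3) by auto
  obtain a1 b1 where 1: "a \<le> a1" "a1 < b1" "b1 \<le> b" "monochrome c X a1 b1 (0, eval_tm \<sigma> s)"
    using Nd.IH(1)[OF XY(3,1) v(1) Nd.prems(4)] by blast
  have "\<forall>i\<in>tm_vars t. monochrome c (v i) a1 b1 (0, \<sigma> i)"
    using v(2)[rule_format, THEN monochrome_mono, OF _ 1(1,3)] by simp
  then obtain a2 b2 where 2: "a1 \<le> a2" "a2 < b2" "b2 \<le> b1" "monochrome c Y a2 b2 (0, eval_tm \<sigma> t)"
    using Nd.IH(2)[OF XY(4,2) _ 1(2)] by blast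
  obtain a3 b3 w where 3: "a2 \<le> a3" "a3 < b3" "b3 \<le> b2" "monochrome c W a3 b3 (0, w)"
    using token_monochrome[OF Nd.prems(2) 2(2)] .
  have le: "a1 \<le> a3" "b3 \<le> b1" "a \<le> a3" "b3 \<le> b" using 1 2 3 by auto
  have "w = Node (eval_tm \<sigma> s) (eval_tm \<sigma> t)"
    by (rule pair_monochrome[OF XY(1,2) Nd.prems(2) XY(5) monochrome_mono[OF 1(4) le(1,2)] monochrome_mono[OF 2(4) 3(1,3)] 3(4,2)])
  then show ?case using 3 le by auto
qed

lemma common_monochrome:
  fixes n :: nat
  assumes "\<forall>i<n. token F Q (D 0) (v i)" "a < b"
  shows "\<exists>a' b' \<sigma>. a \<le> a' \<and> a' < b' \<and> b' \<le> b \<and> (\<forall>i<n. monochrome c (v i) a' b' (0, \<sigma> i))"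
  using assms
proof (induction n)
  case 0
  then show ?case by auto
next
  case (Suc n)
  then obtain a' b' \<sigma> where 1: "a \<le> a'" "a' < b'" "b' \<le> b" "\<forall>i<n. monochrome c (v i) a' b' (0, \<sigma> i)"
    by auto
  have "token F Q (D 0) (v n)" using Suc.prems by simp
  then obtain a'' b'' t where 2: "a' \<le> a''" "a'' < b''" "b'' \<le> b'" "monochrome c (v n) a'' b'' (0, t)"
    using token_monochrome[OF _ 1(2)] by blast
  have "\<forall>i<Suc n. monochrome c (v i) a'' b'' (0, (\<sigma>(n := t)) i)"
    using 1(4)[rule_format, THEN monochrome_mono, OF _ 2(1,3)] 2(4) by (simp add: less_Suc_eq)
  moreover have "a \<le> a''" "b'' \<le> b" using 1 2 by auto
  ultimately show ?case using 2(2) by blast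
qed

text \<open>Horn clauses are checked locally: any interval contains one where all six term variables
  are constant. There the premises become true facts about these constants, so the head does too, as
  \<open>true_facts\<close> is closed.\<close>

lemma model_ok_coded: "model_ok F Q D zero_token fact_points"
proof -
  have "clause_ok F Q D zero_token fact_points cl" if cl: "cl \<in> set computes_clauses" for cl
    unfolding clause_ok_def
  proof (intro allI impI ballI)
    fix v W
    assume v: "\<forall>i<6. v i \<in> F \<and> token F Q (D 0) (v i)" and "W \<in> F"
      and W: "token F Q (D 0) W \<and> represents F Q D zero_token v (snd cl) W \<and>
        (\<forall>p\<in>set (fst cl). \<exists>X\<in>F. token F Q (D 0) X \<and> represents F Q D zero_token v p X \<and> nearly_in fact_points X)"
    show "nearly_in fact_points W"
      unfolding fact_points_def
    proof (rule nearly_in_I)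
      show "token F Q (D 0) W" using W by simp
      fix a b :: real assume "a < b"
      then obtain a1 b1 \<sigma> where 1: "a \<le> a1" "a1 < b1" "b1 \<le> b" "\<forall>i<6. monochrome c (v i) a1 b1 (0, \<sigma> i)"
        using common_monochrome[of 6 v a b] v by auto
      have vars: "\<forall>i\<in>tm_vars t. monochrome c (v i) a1 b1 (0, \<sigma> i)" if "tm_vars t \<subseteq> {..<6}" for t
        using 1(4) that by auto
      \<comment> \<open>Each premise may be evaluated on a subinterval of its own, since
        \<open>\<sigma>\<close> describes the variables on the whole interval.\<close>
      have "eval_tm \<sigma> p \<in> true_facts" if p: "p \<in> set (fst cl)" for p
      proof -
        obtain X where X: "token F Q (D 0) X" "represents F Q D zero_token v p X" "nearly_in fact_points X"
          using W p by blast
        then obtain a2 b2 where "a2 < b2" "monochrome c X a2 b2 (0, eval_tm \<sigma> p)"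
          using represents_monochrome[OF X(2,1) vars 1(2)] computes_clauses_vars(2)[OF cl] p by blast
        then show ?thesis using nearly_in_monochrome[OF X(1)] X(3) by (simp add: fact_points_def)
      qed
      then have "eval_tm \<sigma> (snd cl) \<in> true_facts"
        using closed_true_facts cl unfolding closed_computes_clauses_def by (auto simp: case_prod_beta)
      moreover obtain a2 b2 where "a1 \<le> a2" "a2 < b2" "b2 \<le> b1" "monochrome c W a2 b2 (0, eval_tm \<sigma> (snd cl))"
        using represents_monochrome[OF _ _ vars 1(2), of "snd cl" W] computes_clauses_vars(1)[OF cl] W by blast
      moreover from this have "a \<le> a2" "b2 \<le> b" using 1 by auto
      ultimately show "\<exists>a' b' s. a \<le> a' \<and> a' < b' \<and> b' \<le> b \<and> monochrome c W a' b' (0, s) \<and> s \<in> true_facts"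
        by blast
    qed
  qed
  moreover have "\<exists>W\<in>F. token F Q (D 0) W \<and> pair F Q D X Y W"
    if "token F Q (D 0) X" "token F Q (D 0) Y" for X Y
  proof -
    obtain W where W: "token F Q (D 0) W"
      "pair F Q D X Y W" using exists_pair[OF \<open>token F Q (D 0) X\<close> \<open>token F Q (D 0) Y\<close>] .
    moreover have "W \<in> F" using D_in_F[of W 0] W(1) by (simp add: token_def)
    ultimately show ?thesis by blast
  qed
  ultimately show ?thesis
    using token_colour_class[of 0 Leaf] by (simp add: model_ok_def zero_token_def)
qed

text \<open>The invariant is that variable 8 holds a token with the value \<open>nat_tree m\<close>
  somewhere in every interval. In the end the fact about halting is read off on one interval, and
  membership in \<open>true_facts\<close> gives the computation.\<close>

lemma computes_if_sat_iterated_step: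
  assumes "Qs ! 0 = Q" and E: "\<forall>i<4. E i = D i" "E 4 = fact_points" "E 5 = zero_token"
    and w: "token F Q (D 0) (E 8)"
      "\<And>a b. a < b \<Longrightarrow> \<exists>a' b'. a \<le> a' \<and> a' < b' \<and> b' \<le> b \<and> monochrome c (E 8) a' b' (0, nat_tree m)"
    and sat: "sat F (rmodel Qs) e E ((fStep ^^ n) (fHalt q))"
  shows "computes q [m + n] 0"
  using E w sat
proof (induction n arbitrary: m E)
  case 0
  then obtain W where W: "token F Q (D 0) W" "represents F Q E (E 5) (\<lambda>_. E 8) (halt_tm q) W"
    "nearly_in fact_points W"
    using \<open>Qs ! 0 = Q\<close> by (auto simp: sat_fHalt)
  have "represents F Q D zero_token (\<lambda>_. E 8) (halt_tm q) W"
    using W(2) represents_cong[of E D "halt_tm q" "\<lambda>_. E 8" "\<lambda>_. E 8" F Q zero_token W] 0 by simp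
  \<comment> \<open>One interval suffices to read off the values; it is found between 0 and
    1.\<close>
  moreover obtain a b where ab: "a < b" "monochrome c (E 8) a b (0, nat_tree m)"
    using 0(5)[of 0 1] by auto
  ultimately obtain a' b' where "a' < b'" "monochrome c W a' b' (0, eval_tm (\<lambda>_. nat_tree m) (halt_tm q))"
    using represents_monochrome[of "\<lambda>_. E 8" "halt_tm q" W a b "\<lambda>_. nat_tree m"] W(1) by blast
  then have "eval_tm (\<lambda>_. nat_tree m) (halt_tm q) \<in> true_facts"
    using nearly_in_monochrome[OF W(1)] W(3) by (simp add: fact_points_def)
  then have "fact3 0 (recf_tree q) (nats_tree [m]) (nat_tree 0) \<in> true_facts"
    by (simp add: eval_tm_halt_tm)
  then obtain k where "nat_tree 0 = nat_tree k" "computes q [m] k"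
    unfolding true_facts_iff by blast
  then show ?case by (simp del: nat_tree.simps)
next
  case (Suc n)
  then obtain U where U: "token F Q (D 0) U" "pair F Q E (E 5) (E 8) U"
    "sat F (rmodel Qs) e (E(9 := U, 8 := U)) ((fStep ^^ n) (fHalt q))"
    using \<open>Qs ! 0 = Q\<close> by (auto simp: sat_fStep)
  have pair: "pair F Q D zero_token (E 8) U"
    using U(2) pair_cong[of E D F Q zero_token "E 8" U] Suc.prems by simp
  have zero: "token F Q (D 0) zero_token"
    using token_colour_class[of 0 Leaf] by (simp add: zero_token_def)
  have monochrome: "\<exists>a' b'. a \<le> a' \<and> a' < b' \<and> b' \<le> b \<and> monochrome c U a' b' (0, nat_tree (Suc m))" if ab: "a < b" for a b
  proof -
    obtain a1 b1 where 1: "a \<le> a1" "a1 < b1" "b1 \<le> b" "monochrome c (E 8) a1 b1 (0, nat_tree m)"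
      using Suc.prems(5)[OF ab] by blast
    obtain a2 b2 u where 2: "a1 \<le> a2" "a2 < b2" "b2 \<le> b1" "monochrome c U a2 b2 (0, u)"
      using token_monochrome[OF U(1) 1(2)] .
    have "monochrome c zero_token a2 b2 (0, Leaf)" by (simp add: zero_token_def monochrome_def)
    then have "u = Node Leaf (nat_tree m)"
      using pair_monochrome[OF zero Suc.prems(4) U(1) pair _ monochrome_mono[OF 1(4) 2(1,3)] 2(4,2)] by simp
    then show ?thesis using 1 2 by (intro exI[of _ a2] exI[of _ b2]) auto
  qed
  have "computes q [Suc m + n] 0"
    by (rule Suc.IH[of "E(9 := U, 8 := U)", OF _ _ _ _ _ U(3)]) (use Suc.prems U(1) monochrome in auto)
  then show ?case by simp
qed

lemma computes_if_sat_fCtx: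
  assumes "Qs ! 0 = Q" "\<And>e E. sat F (rmodel Qs) e E (fCtx ((fStep ^^ x) (fHalt q)))"
  shows "computes q [x] 0"
proof -
  define E where "E i = (if i < 4 then D i else if i = 4 then fact_points else zero_token)" for i :: nat
  have EF: "E i \<in> F" for i
    using D_in_F[of "D i" i] Pow_Rats by (auto simp: E_def fact_points_def zero_token_def)
  \<comment> \<open>As an update of itself, \<open>E\<close> instantiates the six universal set
    quantifiers of \<open>fCtx\<close>.\<close>
  have upd: "E(0 := E 0, 1 := E 1, 2 := E 2, 3 := E 3, 4 := E 4, 5 := E 5) = E" by simp
  have "sat F (rmodel Qs) e E (Imp fModel (ExS 8 (Conj (fEq 8 5) ((fStep ^^ x) (fHalt q)))))" for e
    using assms(2)[of e E] EF upd unfolding fCtx_def sat_derived by metis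
  moreover have "model_ok F Q E (E 5) (E 4)"
  proof -
    have "pair F Q E X Y W = pair F Q D X Y W" for X Y W
      by (rule pair_cong) (simp add: E_def)
    moreover have "represents F Q E z v t W = represents F Q D z v t W" for z v t W
      by (rule represents_cong) (simp_all add: E_def)
    ultimately show ?thesis
      using model_ok_coded by (simp add: model_ok_def clause_ok_def E_def)
  qed
  ultimately have "sat F (rmodel Qs) e (E(8 := E 5)) ((fStep ^^ x) (fHalt q))" for e
    using assms(1) by simp
  moreover have "monochrome c zero_token a b (0, nat_tree 0)" for a b by (simp add: zero_token_def monochrome_def)
  ultimately have "computes q [0 + x] 0"
    using token_colour_class[of 0 Leaf]
    by (intro computes_if_sat_iterated_step[OF assms(1), of "E(8 := E 5)"])
      (auto simp: E_def zero_token_def)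
  then show ?thesis by simp
qed

end

section \<open>Closedness of the sentences\<close>

definition over :: "nat set \<Rightarrow> mform \<Rightarrow> bool" where
  "over S p \<longleftrightarrow> preds_of p \<subseteq> {0} \<and> free_ind p = {} \<and> free_set p \<subseteq> S"

text \<open>With an upper bound \<open>S\<close> in place of the exact set of free set variables,
  closedness follows by introduction rules.\<close>

lemma over_logical:
  "over S p \<Longrightarrow> over S q \<Longrightarrow> over S (Conj p q)"
  "over S p \<Longrightarrow> over S q \<Longrightarrow> over S (Imp p q)"
  "(\<And>p. p \<in> set ps \<Longrightarrow> over S p) \<Longrightarrow> over S (Conjs ps)"
  "over (insert X S) p \<Longrightarrow> over S (ExS X p)"
  "over (insert X S) p \<Longrightarrow> over S (AllS X p)"
  by (auto simp: over_def)

lemma over_fEq: "{X, Y} \<subseteq> S \<Longrightarrow> over S (fEq X Y)"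
  by (simp add: over_def)

lemma over_fTok: "{U, X} \<subseteq> S \<Longrightarrow> over S (fTok U X k)"
  using free_set_fTok[of U X k] by (auto simp: over_def)

lemma over_fPair: "{1, 2, 3, X, Y, W} \<subseteq> S \<Longrightarrow> over S (fPair X Y W k)"
  using free_set_fPair[of X Y W k] by (auto simp: over_def)

lemma over_fInC: "{4, X} \<subseteq> S \<Longrightarrow> over S (fInC X)"
  by (simp add: over_def)

lemma over_fRep: "{..5} \<union> {w} \<union> (+) 8 ` tm_vars t \<subseteq> S \<Longrightarrow> over S (fRep t w k)"
  using order_trans[OF free_set_fRep] preds_of_fRep by (auto simp: over_def)

lemma over_fAllToks:
  assumes "0 \<in> S" "over ({8..<8 + n} \<union> S) p"
  shows "over S (fAllToks n p)"
  using assms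
proof (induction n arbitrary: S)
  case (Suc n)
  have "{8..<8 + Suc n} \<union> S = {8..<8 + n} \<union> insert (8 + n) S" by auto
  then have "over (insert (8 + n) S) (fAllToks n p)" using Suc by simp
  then show ?case using Suc.prems(1) unfolding fAllToks.simps by (intro over_logical over_fTok) auto
qed simp

lemmas over_intros = over_logical over_fEq over_fTok over_fPair over_fInC over_fRep over_fAllToks

lemma over_fClause:
  assumes "cl \<in> set computes_clauses"
  shows "over {..5} (fClause cl)"
proof -
  have "i < 6" if "i \<in> tm_vars (snd cl)" for i
    using computes_clauses_vars(1)[OF assms] that by auto
  moreover have "i < 6" if "p \<in> set (fst cl)" "i \<in> tm_vars p" for p i
    using computes_clauses_vars(2)[OF assms] that by auto
  ultimately show ?thesis
    unfolding fClause_def by (intro over_intros) (force intro!: over_intros)+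
qed

lemma over_fModel: "over {..5} fModel"
  unfolding fModel_def by (intro over_intros) (auto intro!: over_fClause)

lemma over_iterated_fStep: "over (insert 8 {..5}) ((fStep ^^ n) (fHalt q))"
proof (induction n)
  case 0
  show ?case unfolding funpow_0 fHalt_def by (intro over_intros) (auto simp: tm_vars_halt_tm)
next
  case (Suc n)
  have "over (insert 8 (insert 9 (insert 8 {..5}))) ((fStep ^^ n) (fHalt q))"
    using Suc by (auto simp: over_def)
  then show ?case unfolding funpow.simps o_apply fStep_def by (intro over_intros) auto
qed

lemma monadic_sentence_fCtx:
  assumes "n \<ge> 1"
  shows "monadic_sentence n (fCtx ((fStep ^^ x) (fHalt q)))"
proof -
  have "over {} (fCtx ((fStep ^^ x) (fHalt q)))"
    using over_fModel over_iterated_fStep[of x q]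
    unfolding fCtx_def by (intro over_intros) (auto simp: over_def)
  then show ?thesis using assms by (auto simp: over_def monadic_sentence_def)
qed

text \<open>The sentences built from \<open>fHalt\<close> reduce the question whether a program
  yields 0 to the theory: validity in the coded structure gives the computation, and a computation
  gives validity in all structures.\<close>

theorem undecidable_monadic_theory:
  assumes "continuum_hypothesis" "n \<ge> 1" "Pow \<rat> \<subseteq> F"
  shows "\<not> decidable_theory (monadic_theory n F (real_models n))"
proof (rule undecidable_by_diagonalization[OF code_computable_fCtx code_computable_fStep])
  fix q x
  obtain Q c where "coded F Q c" using exists_coded[OF assms(1,3)] .
  then interpret coded F Q c .
  let ?S = "fCtx ((fStep ^^ x) (fHalt q))"
  have in_iff: "?S \<in> monadic_theory n F (real_models n) \<longleftrightarrow>
      (\<forall>Qs e E. length Qs = n \<longrightarrow> sat F (rmodel Qs) e E ?S)"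
    using monadic_sentence_fCtx[OF assms(2)] by (auto simp: monadic_theory_def real_models_def)
  show "?S \<in> monadic_theory n F (real_models n) \<longleftrightarrow> computes q [x] 0"
  proof
    assume "?S \<in> monadic_theory n F (real_models n)"
    \<comment> \<open>The predicate \<open>Q\<close> of the coding comes first, and the other
      predicates are empty.\<close>
    then show "computes q [x] 0"
      using assms(2) by (intro computes_if_sat_fCtx[of "Q # replicate (n - 1) {}"]) (auto simp: in_iff)
  next
    assume "computes q [x] 0"
    then show "?S \<in> monadic_theory n F (real_models n)"
      unfolding in_iff using sat_fCtx_if_computes by blast
  qed
qed

theorem theorem8p2:
  fixes n :: nat
  assumes "continuum_hypothesis" and "n \<ge> 1"
  shows "\<not> decidable_theory (monadic_theory n {A. countable A} (real_models n)) \<and>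
         \<not> decidable_theory (monadic_theory n {A. A \<subseteq> \<rat>} (real_models n))"
proof -
  have "Pow \<rat> \<subseteq> {A :: real set. countable A}"
    using countable_rat countable_subset by blast
  moreover have "Pow \<rat> \<subseteq> {A :: real set. A \<subseteq> \<rat>}" by auto
  ultimately show ?thesis
    using undecidable_monadic_theory[OF assms] by blast
qed

end
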